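(* Let $X$ be a finite simplicial graph and let $G=G(X)$ be the right-angled Artin group with graph $X$. Then $G$ is subgroup separable if and only if $X$ has no full (induced) subgraph isomorphic to a square or to a path of length three.
   Context: A graph is a finite simplicial graph $X$ with vertex set $VX$ and edge set $EX$. The right-angled Artin group $G(X)$ is the group with one generator $g_i$ for each vertex $v_i$ of $X$ and a defining relation $[g_i,g_j]=1$ for each edge between $v_i$ and $v_j$. Subgraphs are always full (induced): two vertices of the subgraph are adjacent in it if and only if they are adjacent in $X$. A path of length three is the graph on four distinct vertices $v_1,v_2,v_3,v_4$ whose edges are exactly $\{v_1,v_2\},\{v_2,v_3\},\{v_3,v_4\}$. A square (closed path of length four) is the graph on four distinct vertices $v_1,v_2,v_3,v_4$ whose edges are exactly $\{v_1,v_2\},\{v_2,v_3\},\{v_3,v_4\},\{v_4,v_1\}$. The profinite topology on a group $G$ is the topology with the cosets of finite index normal subgroups as a base of open sets; a subgroup $H$ is closed (separable) if and only if $H=\bigcap_N HN$, where $N$ ranges over all finite index normal subgroups of $G$. A group is subgroup separable (LERF) if every finitely generated subgroup is closed in its profinite topology. *)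

theory Defs
  imports
    "HOL-Algebra.Generated_Groups"
    "HOL-Analysis.Abstract_Topology"
    "Graph_Theory.Digraph_Isomorphism"
begin

section \<open>Group presentations\<close>

text \<open>
  Words over generators and their formal inverses: \<open>(s, True)\<close> stands for the generator \<open>s\<close>
  and \<open>(s, False)\<close> for its inverse.
\<close>

type_synonym 's group_word = "('s \<times> bool) list"

definition group_words :: "'s set \<Rightarrow> 's group_word set" where
  "group_words S = lists (S \<times> UNIV)"

text \<open>
  The smallest congruence on words over \<open>S\<close> that makes formal inverses inverse to each other and
  identifies every relator in \<open>R\<close> with the empty word.
\<close>

inductive presentation_eq :: "'s set \<Rightarrow> 's group_word set \<Rightarrow> 's group_word \<Rightarrow> 's group_word \<Rightarrow> bool"
  for S R where
  refl: "w \<in> group_words S \<Longrightarrow> presentation_eq S R w w"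
| sym: "presentation_eq S R u v \<Longrightarrow> presentation_eq S R v u"
| trans: "presentation_eq S R u v \<Longrightarrow> presentation_eq S R v w \<Longrightarrow> presentation_eq S R u w"
| cong: "presentation_eq S R u u' \<Longrightarrow> presentation_eq S R v v' \<Longrightarrow> presentation_eq S R (u @ v) (u' @ v')"
| cancel: "s \<in> S \<Longrightarrow> presentation_eq S R [(s, b), (s, \<not> b)] []"
| relator: "r \<in> R \<Longrightarrow> r \<in> group_words S \<Longrightarrow> presentation_eq S R r []"

definition presentation_rel :: "'s set \<Rightarrow> 's group_word set \<Rightarrow> 's group_word rel" where
  "presentation_rel S R = {(u, v). presentation_eq S R u v}"

definition presented_group :: "'s set \<Rightarrow> 's group_word set \<Rightarrow> 's group_word set monoid" where
  "presented_group S R =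
    \<lparr> carrier = group_words S // presentation_rel S R,
      monoid.mult = (\<lambda>A B. \<Union>a\<in>A. \<Union>b\<in>B. presentation_rel S R `` {a @ b}),
      monoid.one = presentation_rel S R `` {[]} \<rparr>"

lemma presentation_eq_words:
  "presentation_eq S R u v \<Longrightarrow> u \<in> group_words S \<and> v \<in> group_words S"
  by (induction rule: presentation_eq.induct) (auto simp: group_words_def)

lemma equiv_presentation_rel: "equiv (group_words S) (presentation_rel S R)"
  by (auto simp: equiv_def refl_on_def sym_def trans_def presentation_rel_def
      dest: presentation_eq_words
      intro: presentation_eq.refl presentation_eq.sym presentation_eq.trans)

lemma carrier_presented_group:
  "A \<in> carrier (presented_group S R) \<longleftrightarrow> (\<exists>w\<in>group_words S. A = presentation_rel S R `` {w})"
  by (auto simp: presented_group_def quotient_def)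

lemma presented_group_mult:
  assumes "u \<in> group_words S" "v \<in> group_words S"
  shows "presentation_rel S R `` {u} \<otimes>\<^bsub>presented_group S R\<^esub> presentation_rel S R `` {v}
    = presentation_rel S R `` {u @ v}"
proof -
  have "congruent2 (presentation_rel S R) (presentation_rel S R) (\<lambda>a b. presentation_rel S R `` {a @ b})"
    by (rule congruent2I')
      (rule equiv_class_eq[OF equiv_presentation_rel],
        simp add: presentation_rel_def presentation_eq.cong)
  then show ?thesis
    using UN_equiv_class2[OF equiv_presentation_rel equiv_presentation_rel] assms
    by (simp add: presented_group_def)
qed

lemma presentation_eq_inverse:
  "w \<in> group_words S \<Longrightarrow> presentation_eq S R (rev (map (\<lambda>(s, b). (s, \<not> b)) w) @ w) []"
proof (induction w)
  case Nil
  then show ?case by (auto intro: presentation_eq.refl)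
next
  case (Cons x w)
  obtain s b where x: "x = (s, b)" by (cases x)
  have s: "s \<in> S" and w: "w \<in> group_words S" using Cons.prems x by (auto simp: group_words_def)
  let ?i = "rev (map (\<lambda>(s, b). (s, \<not> b)) w)"
  have i: "?i \<in> group_words S" using w by (auto simp: group_words_def)
  have "presentation_eq S R ([(s, \<not> b), (s, b)] @ w) ([] @ w)"
    using presentation_eq.cong[OF presentation_eq.cancel[OF s, of R "\<not> b"] presentation_eq.refl[OF w]]
    by simp
  then have "presentation_eq S R (?i @ ([(s, \<not> b), (s, b)] @ w)) (?i @ ([] @ w))"
    by (rule presentation_eq.cong[OF presentation_eq.refl[OF i]])
  then have "presentation_eq S R (?i @ ([(s, \<not> b), (s, b)] @ w)) []"
    by (rule presentation_eq.trans) (use Cons.IH[OF w] in simp)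
  then show ?case using x by simp
qed

lemma group_presented_group: "group (presented_group S R)"
proof (rule groupI)
  let ?G = "presented_group S R" and ?r = "presentation_rel S R"
  have one: "\<one>\<^bsub>?G\<^esub> = ?r `` {[]}" by (simp add: presented_group_def)
  have nil: "[] \<in> group_words S" by (simp add: group_words_def)
  have app: "u @ v \<in> group_words S" if "u \<in> group_words S" "v \<in> group_words S" for u v
    using that by (auto simp: group_words_def)
  show "\<one>\<^bsub>?G\<^esub> \<in> carrier ?G" using one nil carrier_presented_group by blast
  fix x assume "x \<in> carrier ?G"
  then obtain u where u: "u \<in> group_words S" "x = ?r `` {u}" using carrier_presented_group by blast
  show "\<one>\<^bsub>?G\<^esub> \<otimes>\<^bsub>?G\<^esub> x = x" using u nil by (simp add: one presented_group_mult)
  let ?i = "rev (map (\<lambda>(s, b). (s, \<not> b)) u)"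
  have i: "?i \<in> group_words S" using u by (auto simp: group_words_def)
  have "?r `` {?i @ u} = ?r `` {[]}"
    using presentation_eq_inverse[OF u(1)]
    by (intro equiv_class_eq[OF equiv_presentation_rel]) (simp add: presentation_rel_def)
  then have "?r `` {?i} \<otimes>\<^bsub>?G\<^esub> x = \<one>\<^bsub>?G\<^esub>" using u i by (simp add: one presented_group_mult)
  then show "\<exists>y\<in>carrier ?G. y \<otimes>\<^bsub>?G\<^esub> x = \<one>\<^bsub>?G\<^esub>" using i carrier_presented_group by blast
  fix y assume "y \<in> carrier ?G"
  then obtain v where v: "v \<in> group_words S" "y = ?r `` {v}" using carrier_presented_group by blast
  show "x \<otimes>\<^bsub>?G\<^esub> y \<in> carrier ?G"
    using u v app carrier_presented_group by (metis presented_group_mult)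
  fix z assume "z \<in> carrier ?G"
  then obtain w where w: "w \<in> group_words S" "z = ?r `` {w}" using carrier_presented_group by blast
  show "x \<otimes>\<^bsub>?G\<^esub> y \<otimes>\<^bsub>?G\<^esub> z = x \<otimes>\<^bsub>?G\<^esub> (y \<otimes>\<^bsub>?G\<^esub> z)"
    using u v w app by (simp add: presented_group_mult)
qed

section \<open>Right-angled Artin groups\<close>

definition commutator_word :: "'s \<Rightarrow> 's \<Rightarrow> 's group_word" where
  "commutator_word s t = [(s, True), (t, True), (s, False), (t, False)]"

definition raag :: "('v, 'e) pre_digraph \<Rightarrow> 'v group_word set monoid" where
  "raag X = presented_group (verts X) {commutator_word u v |u v. u \<rightarrow>\<^bsub>X\<^esub> v}"

section \<open>Full subgraphs\<close>

text \<open>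
  Finite simplicial graphs are rendered by the locale \<open>graph\<close>: finite loop-free digraphs without
  parallel arcs and with symmetric adjacency, so that an edge is a pair of opposite arcs.
\<close>

definition has_full_subgraph_iso :: "('v, 'e) pre_digraph \<Rightarrow> ('w, 'f) pre_digraph \<Rightarrow> bool" where
  "has_full_subgraph_iso X Y \<longleftrightarrow> (\<exists>Z. induced_subgraph Z X \<and> digraph_iso Z Y)"

definition undirected_graph :: "'w set \<Rightarrow> 'w rel \<Rightarrow> ('w, 'w \<times> 'w) pre_digraph" where
  "undirected_graph V E = with_proj \<lparr> pverts = V, parcs = E \<union> E\<inverse> \<rparr>"

definition path_length_3 :: "(nat, nat \<times> nat) pre_digraph" where
  "path_length_3 = undirected_graph {1, 2, 3, 4} {(1, 2), (2, 3), (3, 4)}"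

definition square :: "(nat, nat \<times> nat) pre_digraph" where
  "square = undirected_graph {1, 2, 3, 4} {(1, 2), (2, 3), (3, 4), (4, 1)}"

lemma graph_path_length_3: "graph path_length_3" and graph_square: "graph square"
  by (unfold_locales; auto simp: path_length_3_def square_def undirected_graph_def
      arc_to_ends_def symmetric_def sym_def)+

section \<open>Subgroup separability\<close>

definition finite_index_normal :: "'g set \<Rightarrow> ('g, 'm) monoid_scheme \<Rightarrow> bool" where
  "finite_index_normal N G \<longleftrightarrow> N \<lhd> G \<and> finite (rcosets\<^bsub>G\<^esub> N)"

text \<open>
  Cosets of normal subgroups are two-sided, so right cosets suffice. By \<open>openin_profinite_topology\<close>
  below, they are a base.
\<close>

definition profinite_topology :: "('g, 'm) monoid_scheme \<Rightarrow> 'g topology" where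
  "profinite_topology G =
    topology (arbitrary union_of (\<lambda>U. \<exists>N. finite_index_normal N G \<and> U \<in> rcosets\<^bsub>G\<^esub> N))"

definition finitely_generated_subgroup :: "'g set \<Rightarrow> ('g, 'm) monoid_scheme \<Rightarrow> bool" where
  "finitely_generated_subgroup H G \<longleftrightarrow> (\<exists>A. finite A \<and> A \<subseteq> carrier G \<and> H = generate G A)"

definition subgroup_separable :: "('g, 'm) monoid_scheme \<Rightarrow> bool" where
  "subgroup_separable G \<longleftrightarrow>
    (\<forall>H. finitely_generated_subgroup H G \<longrightarrow> closedin (profinite_topology G) H)"

lemma (in group) finite_index_normal_Int:
  assumes M: "finite_index_normal M G" and N: "finite_index_normal N G"
  shows "finite_index_normal (M \<inter> N) G"
proof -
  have sub: "M \<lhd> G" "N \<lhd> G" using M N by (auto simp: finite_index_normal_def)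
  interpret M: normal M G by fact
  interpret N: normal N G by fact
  have "(M \<inter> N) #> x = (M #> x) \<inter> (N #> x)" if "x \<in> carrier G" for x
    using that M.subset N.subset by (auto simp: r_coset_def subset_iff)
  then have "rcosets (M \<inter> N) \<subseteq> (\<lambda>(A, B). A \<inter> B) ` ((rcosets M) \<times> (rcosets N))"
    by (auto simp: RCOSETS_def)
  then have "finite (rcosets (M \<inter> N))"
    using M N by (auto simp: finite_index_normal_def intro: finite_subset)
  then show ?thesis
    using normal_subgroup_intersect[OF sub] by (simp add: finite_index_normal_def)
qed

lemma (in group) openin_profinite_topology:
  "openin (profinite_topology G) =
    arbitrary union_of (\<lambda>U. \<exists>N. finite_index_normal N G \<and> U \<in> rcosets N)"
  (is "_ = arbitrary union_of ?P")
proof -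
  have "(arbitrary union_of ?P) (S \<inter> T)" if "?P S" "?P T" for S T
  proof -
    obtain M N where M: "finite_index_normal M G" "S \<in> rcosets M"
      and N: "finite_index_normal N G" "T \<in> rcosets N"
      using \<open>?P S\<close> \<open>?P T\<close> by blast
    interpret M: normal M G using M by (simp add: finite_index_normal_def)
    interpret N: normal N G using N by (simp add: finite_index_normal_def)
    note fin = finite_index_normal_Int[OF M(1) N(1)]
    have "\<exists>U. ?P U \<and> x \<in> U \<and> U \<subseteq> S \<inter> T" if x: "x \<in> S \<inter> T" for x
    proof (intro exI conjI)
      have xG: "x \<in> carrier G"
        using x M(2) rcosets_part_G[OF M.subgroup_axioms] by blast
      have "S = M #> x" "T = N #> x"
        using x M(2) N(2) repr_independence[OF _ _ M.subgroup_axioms]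
          repr_independence[OF _ _ N.subgroup_axioms]
        by (auto simp: RCOSETS_def)
      then show "(M \<inter> N) #> x \<subseteq> S \<inter> T" by (auto simp: r_coset_def)
      show "finite_index_normal (M \<inter> N) G" by (fact fin)
      show "(M \<inter> N) #> x \<in> rcosets (M \<inter> N)" using xG by (auto simp: RCOSETS_def)
      show "x \<in> (M \<inter> N) #> x"
        using rcos_self[OF xG] fin normal_imp_subgroup by (auto simp: finite_index_normal_def)
    qed
    then have "S \<inter> T = \<Union>{U. ?P U \<and> U \<subseteq> S \<inter> T}" by blast
    then show ?thesis
      unfolding union_of_def arbitrary_def by (intro exI[of _ "{U. ?P U \<and> U \<subseteq> S \<inter> T}"]) auto
  qed
  then have "istopology (arbitrary union_of ?P)" by (auto simp: istopology_base_eq)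
  then show ?thesis by (simp add: profinite_topology_def)
qed

lemma (in group) closedin_profinite_topology:
  assumes H: "subgroup H G"
  shows "closedin (profinite_topology G) H \<longleftrightarrow>
    H = (\<Inter>N\<in>{N. finite_index_normal N G}. H <#> N)"
proof -
  interpret H: subgroup H G by fact
  define P where "P = (\<lambda>U. \<exists>N. finite_index_normal N G \<and> U \<in> rcosets N)"
  have openin: "openin (profinite_topology G) = arbitrary union_of P"
    by (simp add: openin_profinite_topology P_def)
  have top: "finite_index_normal (carrier G) G"
  proof -
    have "(carrier G) #> x = carrier G" if "x \<in> carrier G" for x
      using that coset_join2 subgroup_self by blast
    then have "rcosets (carrier G) \<subseteq> {carrier G}" by (auto simp: RCOSETS_def)
    moreover have "carrier G \<lhd> G" by (simp add: normal_inv_iff subgroup_self)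
    ultimately show ?thesis
      by (auto simp: finite_index_normal_def intro: finite_subset)
  qed
  have PG: "U \<subseteq> carrier G" if "P U" for U
    using that rcosets_part_G unfolding P_def by (metis Sup_upper finite_index_normal_def normal_imp_subgroup)
  have "carrier G #> \<one> \<in> rcosets (carrier G)" by (rule rcosetsI) auto
  then have "carrier G \<in> rcosets (carrier G)"
    unfolding coset_join2[OF one_closed subgroup_self one_closed] .
  then have PcG: "P (carrier G)" using top unfolding P_def by blast
  have space: "topspace (profinite_topology G) = carrier G"
  proof
    show "topspace (profinite_topology G) \<subseteq> carrier G"
      unfolding topspace_def openin union_of_def arbitrary_def using PG by blast
    have "openin (profinite_topology G) (carrier G)"
      using PcG by (simp add: openin union_of_inc arbitrary_def)
    then show "carrier G \<subseteq> topspace (profinite_topology G)" by (rule openin_subset)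
  qed
  have mem: "x \<in> H <#> N \<longleftrightarrow> \<not> (N #> x) \<inter> H = {}"
    if x: "x \<in> carrier G" and N: "finite_index_normal N G" for x N
  proof -
    interpret N: normal N G using N by (simp add: finite_index_normal_def)
    have "x \<in> H <#> N \<longleftrightarrow> x \<in> N <#> H" using commut_normal[OF H N.normal_axioms] by simp
    also have "\<dots> \<longleftrightarrow> \<not> (N #> x) \<inter> H = {}"
    proof
      assume "x \<in> N <#> H"
      then obtain n h where "n \<in> N" "h \<in> H" "x = n \<otimes> h" by (auto simp: set_mult_def)
      then have "inv n \<otimes> x = h" "inv n \<in> N"
        using N.subset H.subset by (auto simp: m_assoc[symmetric] subset_iff)
      then show "\<not> (N #> x) \<inter> H = {}" using \<open>h \<in> H\<close> by (auto simp: r_coset_def)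
    next
      assume "\<not> (N #> x) \<inter> H = {}"
      then obtain n where n: "n \<in> N" "n \<otimes> x \<in> H" by (auto simp: r_coset_def)
      have "x = inv n \<otimes> (n \<otimes> x)" using n x N.subset by (auto simp: m_assoc[symmetric] subset_iff)
      then show "x \<in> N <#> H" using n by (force simp: set_mult_def)
    qed
    finally show ?thesis .
  qed
  have "closedin (profinite_topology G) H \<longleftrightarrow> openin (profinite_topology G) (carrier G - H)"
    using H.subset by (simp add: closedin_def space)
  also have "\<dots> \<longleftrightarrow> (\<forall>x\<in>carrier G - H. \<exists>U. P U \<and> x \<in> U \<and> U \<inter> H = {})"
  proof
    assume "openin (profinite_topology G) (carrier G - H)"
    then obtain \<U> where \<U>: "\<U> \<subseteq> Collect P" "\<Union>\<U> = carrier G - H"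
      unfolding openin union_of_def arbitrary_def by auto
    have "P U \<and> U \<inter> H = {}" if "U \<in> \<U>" for U
      using \<U>(1) Union_upper[OF that] that unfolding \<U>(2) by blast
    then show "\<forall>x\<in>carrier G - H. \<exists>U. P U \<and> x \<in> U \<and> U \<inter> H = {}"
      unfolding \<U>(2)[symmetric] by (meson UnionE)
  next
    assume "\<forall>x\<in>carrier G - H. \<exists>U. P U \<and> x \<in> U \<and> U \<inter> H = {}"
    then have "\<Union>{U. P U \<and> U \<inter> H = {}} = carrier G - H" using PG by blast
    then show "openin (profinite_topology G) (carrier G - H)"
      unfolding openin union_of_def arbitrary_def
      by (intro exI[of _ "{U. P U \<and> U \<inter> H = {}}"]) auto
  qed
  also have "\<dots> \<longleftrightarrow> (\<forall>x\<in>carrier G - H. \<exists>N. finite_index_normal N G \<and> (N #> x) \<inter> H = {})"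
  proof -
    have "(\<exists>U. P U \<and> x \<in> U \<and> U \<inter> H = {}) \<longleftrightarrow> (\<exists>N. finite_index_normal N G \<and> (N #> x) \<inter> H = {})"
      if x: "x \<in> carrier G" for x
    proof
      assume "\<exists>U. P U \<and> x \<in> U \<and> U \<inter> H = {}"
      then obtain U N where U: "finite_index_normal N G" "U \<in> rcosets N" "x \<in> U" "U \<inter> H = {}"
        unfolding P_def by blast
      moreover have "subgroup N G"
        using U(1) normal_imp_subgroup unfolding finite_index_normal_def by blast
      ultimately have "U = N #> x"
        using repr_independence[of x N] unfolding RCOSETS_def by blast
      then show "\<exists>N. finite_index_normal N G \<and> (N #> x) \<inter> H = {}" using U by blast
    next
      assume "\<exists>N. finite_index_normal N G \<and> (N #> x) \<inter> H = {}"
      then obtain N where N: "finite_index_normal N G" "(N #> x) \<inter> H = {}" by blast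
      then have "subgroup N G"
        using normal_imp_subgroup unfolding finite_index_normal_def by blast
      then have "x \<in> N #> x" "N #> x \<in> rcosets N"
        using x rcos_self rcosetsI[OF subgroup.subset] by blast+
      then show "\<exists>U. P U \<and> x \<in> U \<and> U \<inter> H = {}" using N unfolding P_def by blast
    qed
    then show ?thesis by blast
  qed
  also have "\<dots> \<longleftrightarrow> (\<forall>x\<in>carrier G - H. \<exists>N. finite_index_normal N G \<and> x \<notin> H <#> N)"
    using mem by (metis DiffD1)
  also have "\<dots> \<longleftrightarrow> H = (\<Inter>N\<in>{N. finite_index_normal N G}. H <#> N)"
  proof -
    have 1: "H \<subseteq> H <#> N" if N: "finite_index_normal N G" for N
    proof
      fix h assume h: "h \<in> H"
      have "h \<otimes> \<one> \<in> H <#> N"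
        using h N normal_imp_subgroup[THEN subgroup.one_closed]
        unfolding finite_index_normal_def set_mult_def by blast
      then show "h \<in> H <#> N" using h by simp
    qed
    have 2: "H <#> carrier G \<subseteq> carrier G" using H.subset by (auto simp: set_mult_def)
    define I where "I = (\<Inter>N\<in>{N. finite_index_normal N G}. H <#> N)"
    have "H \<subseteq> I" unfolding I_def using 1 by (intro INF_greatest) simp
    moreover have "I \<subseteq> carrier G"
      unfolding I_def by (rule INF_lower2[of "carrier G"]) (simp_all add: top 2)
    ultimately have "H = I \<longleftrightarrow> (\<forall>x\<in>carrier G - H. x \<notin> I)" by blast
    then show ?thesis by (simp add: I_def)
  qed
  finally show ?thesis .
qed

end

theory Submission
  imports Defs "HOL-Combinatorics.Permutations" "HOL-Algebra.Zassenhaus"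
begin

text \<open>
  Suppose that there is no obstruction. Separability of finitely generated subgroups follows from
  an extension property: given an action of the group on any set and a finite subset \<open>S\<close>, there is an
  action on a finite set \<open>T \<supseteq> S\<close> in which every generator that moves a point of \<open>S\<close> into \<open>S\<close> still
  does so in the same way. It is applied to the left cosets of the subgroup, with \<open>S\<close> the points visited
  when its generators and the element to be separated are spelled out letter by letter from the base
  point. The extension property is proved by induction on the graph: with \<open>C\<close> the set of dominating
  vertices, the rest splits into two nonempty parts \<open>Y\<close>, \<open>Z\<close> without edges between them. After passing
  to a quotient in which the central generators \<open>C\<close> have finite order, \<open>S\<close> may be taken invariant under
  \<open>C\<close>, and finite extensions for \<open>C \<union> Y\<close> and \<open>C \<union> Z\<close> are glued along \<open>S\<close>.

  For the path and the square there are explicit finitely generated subgroups \<open>H\<close> and elements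
  \<open>x \<notin> H\<close> lying in every finite index subgroup that contains \<open>H\<close>; \<open>x \<notin> H\<close> is seen in permutation
  representations on \<open>\<int> \<times> \<int>\<close>. The square uses the fibre product of two free groups over the
  Baumslag--Solitar group \<open>BS(2, 3)\<close>, which is not residually finite.
\<close>

section \<open>Finite extensions of partial actions\<close>

text \<open>An action of the right-angled Artin group on \<open>T\<close>, given by its generators
  alone. As the permutations fix all points off \<open>T\<close>, actions on different sets live in
  one function type and can be compared and glued.\<close>

definition commuting_perms :: "'v set \<Rightarrow> ('v \<Rightarrow> 'v \<Rightarrow> bool) \<Rightarrow> 'b set \<Rightarrow> ('v \<Rightarrow> 'b \<Rightarrow> 'b) \<Rightarrow> bool" where
  "commuting_perms V adj T \<rho> \<longleftrightarrow> (\<forall>v\<in>V. \<rho> v permutes T) \<and>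
    (\<forall>u\<in>V. \<forall>v\<in>V. adj u v \<longrightarrow> \<rho> u \<circ> \<rho> v = \<rho> v \<circ> \<rho> u)"

definition agree_within :: "'v set \<Rightarrow> 'b set \<Rightarrow> ('v \<Rightarrow> 'b \<Rightarrow> 'b) \<Rightarrow> ('v \<Rightarrow> 'b \<Rightarrow> 'b) \<Rightarrow> bool" where
  "agree_within V S \<rho> \<rho>' \<longleftrightarrow> (\<forall>v\<in>V. \<forall>s\<in>S. \<rho> v s \<in> S \<longrightarrow> \<rho>' v s = \<rho> v s)"

text \<open>
  Whether \<open>a\<close> and \<open>d\<close> are adjacent is left open, so this covers both the path and the square.
\<close>

definition obstruction :: "'v set \<Rightarrow> ('v \<Rightarrow> 'v \<Rightarrow> bool) \<Rightarrow> bool" where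
  "obstruction V adj \<longleftrightarrow> (\<exists>a\<in>V. \<exists>b\<in>V. \<exists>c\<in>V. \<exists>d\<in>V. distinct [a, b, c, d] \<and>
    adj a b \<and> adj b c \<and> adj c d \<and> \<not> adj a c \<and> \<not> adj b d)"

lemma commuting_permsD:
  assumes "commuting_perms V adj T \<rho>"
  shows "v \<in> V \<Longrightarrow> \<rho> v permutes T"
    and "u \<in> V \<Longrightarrow> v \<in> V \<Longrightarrow> adj u v \<Longrightarrow> \<rho> u (\<rho> v x) = \<rho> v (\<rho> u x)"
  using assms unfolding commuting_perms_def by (blast, metis comp_apply)

lemma commuting_permsI:
  assumes "\<And>v. v \<in> V \<Longrightarrow> \<rho> v permutes T"
    and "\<And>u v x. u \<in> V \<Longrightarrow> v \<in> V \<Longrightarrow> adj u v \<Longrightarrow> \<rho> u (\<rho> v x) = \<rho> v (\<rho> u x)"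
  shows "commuting_perms V adj T \<rho>"
  using assms unfolding commuting_perms_def comp_def by blast

lemma commuting_perms_subset:
  "commuting_perms V adj T \<rho> \<Longrightarrow> V' \<subseteq> V \<Longrightarrow> commuting_perms V' adj T \<rho>"
  unfolding commuting_perms_def by blast

lemma agree_within_trans:
  "agree_within V S \<rho> \<rho>' \<Longrightarrow> agree_within V S \<rho>' \<rho>'' \<Longrightarrow> agree_within V S \<rho> \<rho>''"
  unfolding agree_within_def by fastforce

section \<open>Splitting a graph without obstructions\<close>

text \<open>
  \<open>Y\<close> is the closed neighbourhood, in the graph without dominating vertices, of a vertex of
  maximal degree there: an edge leaving \<open>Y\<close> would produce an obstruction.
\<close>

lemma split_off_dominating:
  fixes adj :: "'v \<Rightarrow> 'v \<Rightarrow> bool"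
  assumes fin: "finite V" and sym: "\<And>u v. adj u v \<Longrightarrow> adj v u" and irr: "\<And>v. \<not> adj v v"
    and no: "\<not> obstruction V adj"
    and C: "C = {v \<in> V. \<forall>u\<in>V. u \<noteq> v \<longrightarrow> adj v u}" and "V \<noteq> C"
  obtains Y Z where "V = C \<union> Y \<union> Z" "Y \<inter> Z = {}" "C \<inter> Y = {}" "C \<inter> Z = {}" "Y \<noteq> {}" "Z \<noteq> {}"
    "\<And>y z. y \<in> Y \<Longrightarrow> z \<in> Z \<Longrightarrow> \<not> adj y z"
proof -
  define W where "W = V - C"
  have CV: "C \<subseteq> V" using C by blast
  then have W: "W \<noteq> {}" "finite W" using \<open>V \<noteq> C\<close> fin by (auto simp: W_def)
  define N where "N u = {x \<in> W. adj u x}" for u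
  have finN: "finite (N u)" for u using W by (simp add: N_def)
  have "Max ((card \<circ> N) ` W) \<in> (card \<circ> N) ` W" using W by simp
  then obtain w where w: "w \<in> W" "card (N w) = Max ((card \<circ> N) ` W)" by auto
  have max: "card (N u) \<le> card (N w)" if "u \<in> W" for u
    using that W w(2) by simp
  define Y where "Y = insert w (N w)"
  define Z where "Z = W - Y"
  have YW: "Y \<subseteq> W" using w by (auto simp: Y_def N_def)
  have "\<not> adj y z" if y: "y \<in> Y" and z: "z \<in> Z" for y z
  proof
    assume yz: "adj y z"
    have zW: "z \<in> W" "z \<noteq> w" "\<not> adj w z" using z by (auto simp: Z_def Y_def N_def)
    then have yw: "y \<noteq> w" using yz by auto
    then have y': "y \<in> W" "adj w y" using y by (auto simp: Y_def N_def)
    have wz: "{w, z} \<subseteq> N y" using yz y' zW w sym by (auto simp: N_def)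
    \<comment> \<open>Otherwise \<open>y\<close> is adjacent to every other neighbour of
      \<open>w\<close>, and also to \<open>w\<close> and \<open>z\<close>, neither of which lies in
      \<open>N w\<close>; then the degree of \<open>y\<close> exceeds the maximal one.\<close>
    have "\<exists>x\<in>N w. x \<noteq> y \<and> \<not> adj y x"
    proof (rule ccontr)
      assume "\<not> ?thesis"
      then have "N w \<subseteq> insert y (N y - {w, z})" using irr zW by (auto simp: N_def)
      then have "card (N w) \<le> card (insert y (N y - {w, z}))"
        using finN by (intro card_mono) auto
      also have "\<dots> \<le> Suc (card (N y - {w, z}))" using finN by (simp add: card_insert_if)
      finally have "card (N w) \<le> Suc (card (N y - {w, z}))" .
      moreover from wz have "card (N y - {w, z}) = card (N y) - 2" "2 \<le> card (N y)"
        using wz zW(2) card_mono[OF finN wz] by (simp_all add: card_Diff_subset)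
      ultimately show False using max[OF y'(1)] by linarith
    qed
    then obtain x where x: "x \<in> W" "adj w x" "x \<noteq> y" "\<not> adj y x" by (auto simp: N_def)
    have "distinct [x, w, y, z]" using x zW yw yz irr by auto
    moreover have "x \<in> V" "w \<in> V" "y \<in> V" "z \<in> V" using x w y' zW by (auto simp: W_def)
    ultimately have "obstruction V adj"
      unfolding obstruction_def using x zW yz y' sym by blast
    then show False using no by blast
  qed
  \<comment> \<open>If \<open>Z\<close> were empty, \<open>w\<close> would be adjacent to all other
    vertices of \<open>W\<close> and, by symmetry, to \<open>C\<close>, hence dominating.\<close>
  moreover have "Z \<noteq> {}"
  proof
    assume "Z = {}"
    then have "adj w u" if "u \<in> W" "u \<noteq> w" for u using that by (auto simp: Z_def Y_def N_def)
    moreover have "adj w u" if "u \<in> C" "u \<noteq> w" for u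
      using that C w by (auto simp: W_def intro: sym)
    ultimately have "w \<in> C" using w unfolding C W_def by blast
    then show False using w by (simp add: W_def)
  qed
  moreover have "V = C \<union> Y \<union> Z" "Y \<inter> Z = {}" "C \<inter> Y = {}" "C \<inter> Z = {}" "Y \<noteq> {}"
    using YW CV by (auto simp: Z_def W_def Y_def)
  ultimately show ?thesis using that by blast
qed

section \<open>Making central generators act with finite order\<close>

text \<open>The quotient action on \<open>E\<close>-classes is carried by representatives inside the
  same type, all other points being fixed. Since \<open>E\<close> separates \<open>S\<close>, its
  points can serve as representatives, so moves within \<open>S\<close> survive literally.\<close>

lemma quotient_perms:
  fixes \<rho> :: "'v \<Rightarrow> 'b \<Rightarrow> 'b"
  assumes act: "commuting_perms V adj UNIV \<rho>" and E: "equivp E"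
    and resp: "\<And>v x y. v \<in> V \<Longrightarrow> E (\<rho> v x) (\<rho> v y) \<longleftrightarrow> E x y"
    and sep: "\<And>s t. s \<in> S \<Longrightarrow> t \<in> S \<Longrightarrow> E s t \<Longrightarrow> s = t"
  obtains \<rho>' where "commuting_perms V adj UNIV \<rho>'" "agree_within V S \<rho> \<rho>'"
    "\<And>v n. v \<in> V \<Longrightarrow> (\<And>x. E ((\<rho> v ^^ n) x) x) \<Longrightarrow> \<rho>' v ^^ n = id"
proof -
  have refl: "E x x" and sym: "E x y \<Longrightarrow> E y x" and trans: "E x y \<Longrightarrow> E y z \<Longrightarrow> E x z" for x y z
    using E by (auto elim: equivpE dest: reflpD sympD transpD)
  define r where "r x = (if \<exists>s\<in>S. E x s then SOME s. s \<in> S \<and> E x s else SOME y. E x y)" for x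
  have Er: "E x (r x)" for x
    unfolding r_def using someI_ex[of "\<lambda>s. s \<in> S \<and> E x s"] someI[of "E x" x] refl by auto
  have r_eq: "r x = r y" if "E x y" for x y
  proof -
    have "E x = E y" using that E by (simp add: equivp_def)
    then show ?thesis by (simp add: r_def)
  qed
  have r_iff: "r x = r y \<longleftrightarrow> E x y" for x y using r_eq Er sym trans by metis
  have rr: "r (r x) = r x" for x using Er r_iff by metis
  have rS: "r s = s" if "s \<in> S" for s
  proof -
    have "\<exists>t. t \<in> S \<and> E s t" using that refl by blast
    then have "r s \<in> S" using someI_ex[of "\<lambda>t. t \<in> S \<and> E s t"] by (auto simp: r_def)
    then show ?thesis using sep Er that by metis
  qed
  define \<rho>' where "\<rho>' v x = (if r x = x then r (\<rho> v x) else x)" for v x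
  have \<rho>'_r: "\<rho>' v (r x) = r (\<rho> v x)" if "v \<in> V" for v x
    using resp[OF that] Er by (simp add: \<rho>'_def rr r_iff) (use sym in blast)
  have \<rho>'_out: "\<rho>' v x = x" if "r x \<noteq> x" for v x using that by (simp add: \<rho>'_def)
  have ext: "f = g" if "\<And>x. f (r x) = g (r x)" "\<And>x. r x \<noteq> x \<Longrightarrow> f x = g x" for f g :: "'b \<Rightarrow> 'b"
    using that by (metis ext)
  show ?thesis
  proof
    have "\<rho>' v permutes UNIV" if v: "v \<in> V" for v
    proof (rule bij_imp_permutes)
      have \<rho>v: "\<rho> v permutes UNIV" using act v by (rule commuting_permsD)
      show "bij (\<rho>' v)"
      proof (rule bijI)
        have inj: "\<rho>' v x \<noteq> \<rho>' v y" if "r x = x" "r y \<noteq> y" for x y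
          using that by (metis \<rho>'_def rr)
        show "inj (\<rho>' v)"
        proof (rule injI)
          fix x y assume *: "\<rho>' v x = \<rho>' v y"
          then consider "r x = x" "r y = y" | "r x \<noteq> x" "r y \<noteq> y" using inj by metis
          then show "x = y"
          proof cases
            case 1
            then have "r (\<rho> v x) = r (\<rho> v y)" using * by (simp add: \<rho>'_def)
            then have "E x y" using resp[OF v] r_iff by blast
            then show ?thesis using r_eq 1 by metis
          qed (use * \<rho>'_out in simp)
        qed
        have "\<exists>x. y = \<rho>' v x" for y
        proof (cases "r y = y")
          case True
          obtain x where "\<rho> v x = y" using permutes_univ[of "\<rho> v"] \<rho>v by metis
          then have "\<rho>' v (r x) = y" using True \<rho>'_r[OF v] by simp
          then show ?thesis by metis
        qed (use \<rho>'_out in metis)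
        then show "surj (\<rho>' v)" by (auto simp: surj_def)
      qed
    qed simp
    moreover have "\<rho>' u \<circ> \<rho>' v = \<rho>' v \<circ> \<rho>' u" if "u \<in> V" "v \<in> V" "adj u v" for u v
      using commuting_permsD(2)[OF act that] that
      by (intro ext) (simp_all add: \<rho>'_r \<rho>'_out)
    ultimately show "commuting_perms V adj UNIV \<rho>'" by (auto simp: commuting_perms_def)
    show "agree_within V S \<rho> \<rho>'"
      unfolding agree_within_def by (simp add: \<rho>'_def rS)
    show "\<rho>' v ^^ n = id" if v: "v \<in> V" and n: "\<And>x. E ((\<rho> v ^^ n) x) x" for v n
    proof (rule ext)
      have "(\<rho>' v ^^ k) (r x) = r ((\<rho> v ^^ k) x)" for k x
        by (induction k) (simp_all add: \<rho>'_r[OF v])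
      then show "(\<rho>' v ^^ n) (r x) = id (r x)" for x using n r_iff by simp
      show "(\<rho>' v ^^ n) x = id x" if "r x \<noteq> x" for x
        using that by (induction n) (simp_all add: \<rho>'_out)
    qed
  qed
qed

lemma funpow_apply_commute:
  assumes "\<And>x. f (g x) = g (f x)"
  shows "(f ^^ n) (g x) = g ((f ^^ n) x)"
  by (induction n) (simp_all add: assms)

text \<open>If both points lie on a periodic orbit, a return time fixes both. If \<open>t\<close> is
  the \<open>k\<close>-th iterate of \<open>s\<close> on an infinite orbit, no multiple of
  \<open>k + 1\<close> divides \<open>k\<close>. Without a common iterate any exponent works.
  Allowing all multiples of \<open>m\<close> lets one exponent serve several pairs; powers on both
  sides replace negative ones.\<close>

lemma separating_power:
  fixes f :: "'b \<Rightarrow> 'b"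
  assumes f: "inj f" and "s \<noteq> t"
  shows "\<exists>m>0. \<forall>n>0. m dvd n \<longrightarrow> (\<forall>i j. (f ^^ (n * i)) s \<noteq> (f ^^ (n * j)) t)"
proof -
  have inj: "(f ^^ i) x = (f ^^ i) y \<longleftrightarrow> x = y" for i x y
    using inj_fn[OF f, of i] by (simp add: inj_eq)
  \<comment> \<open>The case of a forward iterate. Two points with a common iterate reduce to it by
    injectivity, possibly after exchanging them.\<close>
  have *: "\<exists>m>0. \<forall>n>0. m dvd n \<longrightarrow> (\<forall>i j. (f ^^ (n * i)) s \<noteq> (f ^^ (n * j)) t)"
    if k: "(f ^^ k) s = t" and "s \<noteq> t" for k s t
  proof (cases "\<exists>l>0. (f ^^ l) s = s")
    case True
    then obtain l where l: "l > 0" "(f ^^ l) s = s" by blast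
    have ls: "(f ^^ (l * i)) s = s" for i using l by (induction i) (simp_all add: funpow_add)
    have "(f ^^ (l * i)) t = (f ^^ k) ((f ^^ (l * i)) s)" for i
      using k by (metis add.commute comp_apply funpow_add)
    then have "(f ^^ (l * i)) t = t" for i using ls k by simp
    then show ?thesis using l ls \<open>s \<noteq> t\<close> by (metis dvdE mult.assoc)
  next
    case False
    have eqD: "i = j" if "(f ^^ i) s = (f ^^ j) s" for i j
    proof -
      have "\<not> i < j" if "(f ^^ i) s = (f ^^ j) s" for i j
      proof
        assume "i < j"
        then have "(f ^^ i) ((f ^^ (j - i)) s) = (f ^^ i) s"
          using that by (metis comp_apply funpow_add less_imp_add_positive add_diff_cancel_left')
        then show False using False inj \<open>i < j\<close> zero_less_diff by blast
      qed
      then show ?thesis using that by (metis linorder_neqE_nat)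
    qed
    have "k > 0" using k \<open>s \<noteq> t\<close> by (cases k) auto
    have "(f ^^ (n * i)) s \<noteq> (f ^^ (n * j)) t" if "n > 0" "Suc k dvd n" for n i j
    proof
      assume "(f ^^ (n * i)) s = (f ^^ (n * j)) t"
      then have "(f ^^ (n * i)) s = (f ^^ (n * j + k)) s" using k by (simp add: funpow_add)
      then have "n * i = n * j + k" by (rule eqD)
      then have "n dvd k" by (metis dvd_add_right_iff dvd_triv_left)
      then show False using \<open>k > 0\<close> dvd_imp_le that by (metis Suc_n_not_le_n dvd_trans)
    qed
    then show ?thesis by blast
  qed
  show ?thesis
  proof (cases "\<exists>i j. (f ^^ i) s = (f ^^ j) t")
    case True
    then obtain i j where ij: "(f ^^ i) s = (f ^^ j) t" by blast
    show ?thesis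
    proof (cases "i \<le> j")
      case True
      then have "(f ^^ i) s = (f ^^ i) ((f ^^ (j - i)) t)"
        using ij by (metis comp_apply funpow_add le_add_diff_inverse)
      then have "(f ^^ (j - i)) t = s" using inj by metis
      from *[OF this] \<open>s \<noteq> t\<close> show ?thesis by metis
    next
      case False
      then have "(f ^^ j) ((f ^^ (i - j)) s) = (f ^^ j) t"
        using ij by (metis comp_apply funpow_add le_add_diff_inverse nat_le_linear)
      then have "(f ^^ (i - j)) s = t" using inj by metis
      from *[OF this \<open>s \<noteq> t\<close>] show ?thesis .
    qed
  next
    case False
    then show ?thesis by (intro exI[of _ 1]) auto
  qed
qed

text \<open>
  Pass to the orbits of a suitable power of the central permutation \<open>\<rho> c\<close>, realised on a set of
  representatives that contains \<open>S\<close>.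
\<close>

lemma make_finite_order:
  fixes \<rho> :: "'v \<Rightarrow> 'b \<Rightarrow> 'b"
  assumes act: "commuting_perms V adj UNIV \<rho>" and c: "c \<in> V" "\<And>v. v \<in> V \<Longrightarrow> v \<noteq> c \<Longrightarrow> adj c v"
    and fin: "finite S"
  obtains \<rho>' n where "commuting_perms V adj UNIV \<rho>'" "agree_within V S \<rho> \<rho>'"
    "n > 0" "\<rho>' c ^^ n = id" "\<And>v k. v \<in> V \<Longrightarrow> \<rho> v ^^ k = id \<Longrightarrow> \<rho>' v ^^ k = id"
proof -
  define f where "f = \<rho> c"
  have f: "inj f" using commuting_permsD(1)[OF act c(1)] by (auto simp: f_def intro: permutes_inj)
  have inj: "(f ^^ i) x = (f ^^ i) y \<longleftrightarrow> x = y" for i x y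
    using inj_fn[OF f, of i] by (simp add: inj_eq)
  define M where "M p = (SOME m. m > 0 \<and> (\<forall>n>0. m dvd n \<longrightarrow>
    (\<forall>i j. (f ^^ (n * i)) (fst p) \<noteq> (f ^^ (n * j)) (snd p))))" for p :: "'b \<times> 'b"
  have M: "M (s, t) > 0 \<and> (\<forall>n>0. M (s, t) dvd n \<longrightarrow>
    (\<forall>i j. (f ^^ (n * i)) s \<noteq> (f ^^ (n * j)) t))" if "s \<noteq> t" for s t
    unfolding M_def using someI_ex[OF separating_power[OF f that]] by simp
  define P where "P = S \<times> S - Id"
  \<comment> \<open>A common multiple of the exponents for all pairs, so a single power of
    \<open>f\<close> separates the points of \<open>S\<close>.\<close>
  define n where "n = (\<Prod>p\<in>P. M p)"
  have finP: "finite P" using fin by (simp add: P_def)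
  have "M p > 0" if "p \<in> P" for p using that M by (cases p) (auto simp: P_def)
  then have n: "n > 0" unfolding n_def by (metis neq0_conv finP prod_zero_iff less_irrefl)
  have dvd: "M p dvd n" if "p \<in> P" for p using that finP by (simp add: n_def dvd_prodI)
  \<comment> \<open>The orbit relation of the group generated by \<open>f ^^ n\<close>, written with
    nonnegative powers only.\<close>
  define E where "E x y \<longleftrightarrow> (\<exists>i j. (f ^^ (n * i)) x = (f ^^ (n * j)) y)" for x y
  have trans: "E x z" if xyz: "E x y" "E y z" for x y z
  proof -
    obtain i j k l where *: "(f ^^ (n * i)) x = (f ^^ (n * j)) y" "(f ^^ (n * k)) y = (f ^^ (n * l)) z"
      using xyz unfolding E_def by blast
    have "(f ^^ (n * (k + i))) x = (f ^^ (n * k)) ((f ^^ (n * j)) y)"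
      by (simp only: distrib_left funpow_add comp_apply *)
    also have "\<dots> = (f ^^ (n * j)) ((f ^^ (n * k)) y)"
      by (metis add.commute comp_apply funpow_add)
    also have "\<dots> = (f ^^ (n * (j + l))) z"
      by (simp only: distrib_left funpow_add comp_apply *)
    finally show ?thesis unfolding E_def by blast
  qed
  have "equivp E"
  proof (rule equivpI)
    show "reflp E" unfolding E_def by (rule reflpI) blast
    show "symp E" unfolding E_def by (rule sympI) metis
    show "transp E" using trans by (blast intro: transpI)
  qed
  moreover have "E (\<rho> v x) (\<rho> v y) \<longleftrightarrow> E x y" if v: "v \<in> V" for v x y
  proof -
    have "f (\<rho> v x) = \<rho> v (f x)" for x
      unfolding f_def using commuting_permsD(2)[OF act c(1) v c(2)[OF v]] by (cases "v = c") auto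
    then have "(f ^^ i) (\<rho> v x) = \<rho> v ((f ^^ i) x)" for i x by (rule funpow_apply_commute)
    moreover have "inj (\<rho> v)" using commuting_permsD(1)[OF act v] by (rule permutes_inj)
    ultimately show ?thesis by (simp add: E_def inj_eq)
  qed
  moreover have "s = t" if "s \<in> S" "t \<in> S" "E s t" for s t
  proof (rule ccontr)
    assume "s \<noteq> t"
    then have "(s, t) \<in> P" using that by (simp add: P_def)
    from dvd[OF this] show False using M[OF \<open>s \<noteq> t\<close>] n that(3) unfolding E_def by blast
  qed
  ultimately obtain \<rho>' where \<rho>': "commuting_perms V adj UNIV \<rho>'" "agree_within V S \<rho> \<rho>'"
    "\<And>v n. v \<in> V \<Longrightarrow> (\<And>x. E ((\<rho> v ^^ n) x) x) \<Longrightarrow> \<rho>' v ^^ n = id"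
    using quotient_perms[OF act] by metis
  show ?thesis
  proof (rule that[OF \<rho>'(1,2) n])
    have "E ((f ^^ n) x) x" for x
      unfolding E_def by (intro exI[of _ 0] exI[of _ 1]) simp
    then show "\<rho>' c ^^ n = id" using \<rho>'(3)[OF c(1)] by (simp add: f_def)
    \<comment> \<open>Here the required relation is reflexivity of \<open>E\<close>: orders already
      made finite survive the passage to the quotient.\<close>
    show "\<rho>' v ^^ k = id" if "v \<in> V" "\<rho> v ^^ k = id" for v k
      using \<rho>'(3)[OF that(1), of k] that(2) equivp_reflp[OF \<open>equivp E\<close>] by simp
  qed
qed

text \<open>Central vertices are treated one at a time; each new quotient keeps the finite orders
  reached before, and agreement on \<open>S\<close> composes.\<close>

lemma make_finite_orders:
  fixes \<rho> :: "'v \<Rightarrow> 'b \<Rightarrow> 'b"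
  assumes act: "commuting_perms V adj UNIV \<rho>" and "finite C" "C \<subseteq> V"
    and "\<And>c v. c \<in> C \<Longrightarrow> v \<in> V \<Longrightarrow> v \<noteq> c \<Longrightarrow> adj c v" and fin: "finite S"
  shows "\<exists>\<rho>'. commuting_perms V adj UNIV \<rho>' \<and> agree_within V S \<rho> \<rho>' \<and>
    (\<forall>c\<in>C. \<exists>n>0. \<rho>' c ^^ n = id)"
  using assms(2-4)
proof (induction C rule: finite_induct)
  case empty
  then show ?case using act by (auto simp: agree_within_def)
next
  case (insert c F)
  then have "\<exists>\<rho>'. commuting_perms V adj UNIV \<rho>' \<and> agree_within V S \<rho> \<rho>' \<and>
      (\<forall>c\<in>F. \<exists>n>0. \<rho>' c ^^ n = id)"
    by blast
  then obtain \<rho>1 where \<rho>1: "commuting_perms V adj UNIV \<rho>1" "agree_within V S \<rho> \<rho>1"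
    "\<And>d. d \<in> F \<Longrightarrow> \<exists>n>0. \<rho>1 d ^^ n = id" by blast
  have c: "c \<in> V" "\<And>v. v \<in> V \<Longrightarrow> v \<noteq> c \<Longrightarrow> adj c v"
    and FV: "F \<subseteq> V" using insert.prems by simp_all
  obtain \<rho>2 n where \<rho>2: "commuting_perms V adj UNIV \<rho>2" "agree_within V S \<rho>1 \<rho>2"
    "n > 0" "\<rho>2 c ^^ n = id" "\<And>v k. v \<in> V \<Longrightarrow> \<rho>1 v ^^ k = id \<Longrightarrow> \<rho>2 v ^^ k = id"
    by (rule make_finite_order[OF \<rho>1(1) c fin]) (assumption | blast)+
  have "\<exists>n>0. \<rho>2 d ^^ n = id" if d: "d \<in> F" for d
  proof -
    obtain k where "k > 0" "\<rho>1 d ^^ k = id" using \<rho>1(3)[OF d] by blast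
    moreover have "d \<in> V" using d FV by blast
    ultimately show ?thesis using \<rho>2(5) by blast
  qed
  then show ?case
    using \<rho>2(1,3,4) agree_within_trans[OF \<rho>1(2) \<rho>2(2)] by blast
qed

text \<open>Finite order means that finitely many iterates close a finite set up under one
  generator; commutation preserves the invariance under the generators treated earlier.\<close>

lemma finite_invariant_superset:
  fixes \<rho> :: "'v \<Rightarrow> 'b \<Rightarrow> 'b"
  assumes "finite C" and "\<And>c d x. c \<in> C \<Longrightarrow> d \<in> C \<Longrightarrow> \<rho> c (\<rho> d x) = \<rho> d (\<rho> c x)"
    and "\<And>c. c \<in> C \<Longrightarrow> \<exists>n>0. \<rho> c ^^ n = id" and "finite S"
  shows "\<exists>S'. finite S' \<and> S \<subseteq> S' \<and> (\<forall>c\<in>C. \<rho> c ` S' \<subseteq> S')"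
  using assms(1-3)
proof (induction C rule: finite_induct)
  case empty
  then show ?case using assms(4) by blast
next
  case (insert c F)
  then obtain S1 where S1: "finite S1" "S \<subseteq> S1" "\<And>d. d \<in> F \<Longrightarrow> \<rho> d ` S1 \<subseteq> S1" by auto
  obtain n where n: "n > 0" "\<rho> c ^^ n = id" using insert.prems by blast
  define S2 where "S2 = (\<Union>i<n. (\<rho> c ^^ i) ` S1)"
  have S2I: "(\<rho> c ^^ i) s \<in> S2" if "i < n" "s \<in> S1" for i s using that by (auto simp: S2_def)
  have "finite S2" using S1 by (simp add: S2_def)
  moreover have "S \<subseteq> S2" using S1(2) S2I[OF n(1)] by auto
  moreover have "\<rho> c ` S2 \<subseteq> S2"
  proof safe
    fix x assume "x \<in> S2"
    then obtain i s where *: "i < n" "s \<in> S1" "x = (\<rho> c ^^ i) s" by (auto simp: S2_def)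
    show "\<rho> c x \<in> S2"
    proof (cases "Suc i = n")
      case True
      \<comment> \<open>The last iterate wraps round to \<open>s\<close> itself.\<close>
      then have "\<rho> c x = (\<rho> c ^^ n) s" using *(3) by auto
      then have "\<rho> c x = (\<rho> c ^^ 0) s" using n by simp
      then show ?thesis using S2I[OF n(1) *(2)] by simp
    next
      case False
      then have "Suc i < n" "\<rho> c x = (\<rho> c ^^ Suc i) s" using * by auto
      then show ?thesis using S2I *(2) by metis
    qed
  qed
  moreover have "\<rho> d ` S2 \<subseteq> S2" if d: "d \<in> F" for d
  proof safe
    fix x assume "x \<in> S2"
    then obtain i s where *: "i < n" "s \<in> S1" "x = (\<rho> c ^^ i) s" by (auto simp: S2_def)
    have "\<rho> d x = (\<rho> c ^^ i) (\<rho> d s)"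
      unfolding *(3) by (rule funpow_apply_commute[symmetric], rule insert.prems(1)) (use d in simp_all)
    moreover have "\<rho> d s \<in> S1" using S1(3)[OF d] * by blast
    ultimately show "\<rho> d x \<in> S2" using S2I[OF *(1)] by simp
  qed
  ultimately show ?case by (intro exI[of _ S2]) simp
qed

section \<open>Gluing finite actions\<close>

text \<open>
  On the part of \<open>T\<^sub>2\<close> outside \<open>T\<^sub>1\<close> the vertices of \<open>Y\<close> act trivially, and vice versa; the central
  vertices \<open>C\<close> already act compatibly on both parts.
\<close>

lemma glue_perms:
  fixes \<rho>\<^sub>1 \<rho>\<^sub>2 :: "'v \<Rightarrow> 'b \<Rightarrow> 'b"
  assumes act1: "commuting_perms (C \<union> Y) adj T\<^sub>1 \<rho>\<^sub>1" and act2: "commuting_perms (C \<union> Z) adj T\<^sub>2 \<rho>\<^sub>2"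
    and fin: "finite T\<^sub>1" "finite T\<^sub>2"
    and eq: "\<And>c s. c \<in> C \<Longrightarrow> s \<in> T\<^sub>1 \<inter> T\<^sub>2 \<Longrightarrow> \<rho>\<^sub>1 c s = \<rho>\<^sub>2 c s"
    and disj: "Y \<inter> Z = {}" "C \<inter> Y = {}" "C \<inter> Z = {}"
    and nonadj: "\<And>y z. y \<in> Y \<Longrightarrow> z \<in> Z \<Longrightarrow> \<not> adj y z \<and> \<not> adj z y"
  obtains \<rho> where "commuting_perms (C \<union> Y \<union> Z) adj (T\<^sub>1 \<union> T\<^sub>2) \<rho>"
    "\<And>v x. v \<in> C \<union> Y \<Longrightarrow> x \<in> T\<^sub>1 \<Longrightarrow> \<rho> v x = \<rho>\<^sub>1 v x"
    "\<And>v x. v \<in> C \<union> Z \<Longrightarrow> x \<in> T\<^sub>2 \<Longrightarrow> \<rho> v x = \<rho>\<^sub>2 v x"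
proof -
  \<comment> \<open>The preference for \<open>T\<^sub>1\<close> on \<open>C\<close> is harmless: the
    two actions of \<open>C\<close> agree on the overlap.\<close>
  define \<rho> where "\<rho> v = (if v \<in> Z then \<rho>\<^sub>2 v else if v \<in> Y then \<rho>\<^sub>1 v else
    (\<lambda>x. if x \<in> T\<^sub>1 then \<rho>\<^sub>1 v x else \<rho>\<^sub>2 v x))" for v
  have p1: "\<rho>\<^sub>1 v permutes T\<^sub>1" if "v \<in> C \<union> Y" for v using commuting_permsD(1)[OF act1 that] .
  have p2: "\<rho>\<^sub>2 v permutes T\<^sub>2" if "v \<in> C \<union> Z" for v using commuting_permsD(1)[OF act2 that] .
  have Y: "\<rho> y = \<rho>\<^sub>1 y" if "y \<in> Y" for y using that disj by (auto simp: \<rho>_def)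
  have Z: "\<rho> z = \<rho>\<^sub>2 z" if "z \<in> Z" for z using that disj by (auto simp: \<rho>_def)
  have C: "\<rho> c x = (if x \<in> T\<^sub>1 then \<rho>\<^sub>1 c x else \<rho>\<^sub>2 c x)" if "c \<in> C" for c x
    using that disj by (auto simp: \<rho>_def)
  have C1: "\<rho> c x = \<rho>\<^sub>1 c x" if "c \<in> C" "x \<in> T\<^sub>1" for c x using that by (simp add: C)
  have C2: "\<rho> c x = \<rho>\<^sub>2 c x" if "c \<in> C" "x \<in> T\<^sub>2" for c x using that eq by (simp add: C)
  have in1: "\<rho>\<^sub>1 v x \<in> T\<^sub>1 \<longleftrightarrow> x \<in> T\<^sub>1" if "v \<in> C \<union> Y" for v x using permutes_in_image[OF p1[OF that]] .
  have in2: "\<rho>\<^sub>2 v x \<in> T\<^sub>2 \<longleftrightarrow> x \<in> T\<^sub>2" if "v \<in> C \<union> Z" for v x using permutes_in_image[OF p2[OF that]] .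
  have out1: "\<rho>\<^sub>1 v x = x" if "v \<in> C \<union> Y" "x \<notin> T\<^sub>1" for v x using permutes_not_in[OF p1] that by metis
  have out2: "\<rho>\<^sub>2 v x = x" if "v \<in> C \<union> Z" "x \<notin> T\<^sub>2" for v x using permutes_not_in[OF p2] that by metis
  \<comment> \<open>The finite overlap is mapped into itself injectively, hence onto itself, so no
    point from outside can enter it.\<close>
  have S: "\<rho>\<^sub>1 c x \<in> T\<^sub>1 \<inter> T\<^sub>2 \<longleftrightarrow> x \<in> T\<^sub>1 \<inter> T\<^sub>2" if c: "c \<in> C" for c x
  proof -
    have inj: "inj (\<rho>\<^sub>1 c)" using p1 c by (metis UnI1 permutes_inj)
    have "\<rho>\<^sub>1 c x \<in> T\<^sub>1 \<inter> T\<^sub>2" if "x \<in> T\<^sub>1 \<inter> T\<^sub>2" for x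
      using c that eq[OF c that] in1[of c x] in2[of c x] by auto
    then have "\<rho>\<^sub>1 c ` (T\<^sub>1 \<inter> T\<^sub>2) \<subseteq> T\<^sub>1 \<inter> T\<^sub>2" by blast
    then have "\<rho>\<^sub>1 c ` (T\<^sub>1 \<inter> T\<^sub>2) = T\<^sub>1 \<inter> T\<^sub>2"
      using fin inj by (intro endo_inj_surj) (auto intro: inj_on_subset)
    then show ?thesis using inj by (metis inj_image_mem_iff)
  qed
  have S2: "\<rho>\<^sub>2 c x \<in> T\<^sub>1 \<longleftrightarrow> x \<in> T\<^sub>1" if c: "c \<in> C" "x \<in> T\<^sub>2" for c x
  proof -
    have inj: "inj (\<rho>\<^sub>2 c)" using p2 c by (metis UnI1 permutes_inj)
    have "\<rho>\<^sub>2 c x \<in> T\<^sub>1 \<inter> T\<^sub>2" if "x \<in> T\<^sub>1 \<inter> T\<^sub>2" for x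
      using c that eq[OF c(1) that] in1[of c x] in2[of c x] by auto
    then have "\<rho>\<^sub>2 c ` (T\<^sub>1 \<inter> T\<^sub>2) \<subseteq> T\<^sub>1 \<inter> T\<^sub>2" by blast
    then have "\<rho>\<^sub>2 c ` (T\<^sub>1 \<inter> T\<^sub>2) = T\<^sub>1 \<inter> T\<^sub>2"
      using fin inj by (intro endo_inj_surj) (auto intro: inj_on_subset)
    then have "\<rho>\<^sub>2 c x \<in> T\<^sub>1 \<inter> T\<^sub>2 \<longleftrightarrow> x \<in> T\<^sub>1 \<inter> T\<^sub>2" using inj by (metis inj_image_mem_iff)
    then show ?thesis using c in2[of c x] by auto
  qed
  have Cin1: "\<rho> c x \<in> T\<^sub>1 \<longleftrightarrow> x \<in> T\<^sub>1" if c: "c \<in> C" for c x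
    using that in1[of c x] S2[of c x] out2[of c x] by (cases "x \<in> T\<^sub>2") (simp_all add: C)
  have Cin2: "\<rho> c x \<in> T\<^sub>2 \<longleftrightarrow> x \<in> T\<^sub>2" if c: "c \<in> C" for c x
    using that in1[of c x] S[of c x] in2[of c x] by (auto simp: C)
  have Cout: "\<rho> c x = x" if "c \<in> C" "x \<notin> T\<^sub>1 \<union> T\<^sub>2" for c x
    using that out2[of c x] by (simp add: C)
  show ?thesis
  proof
    show "\<rho> v x = \<rho>\<^sub>1 v x" if "v \<in> C \<union> Y" "x \<in> T\<^sub>1" for v x using that Y C1 by auto
    show "\<rho> v x = \<rho>\<^sub>2 v x" if "v \<in> C \<union> Z" "x \<in> T\<^sub>2" for v x using that Z C2 by auto
    have perm: "\<rho> v permutes T\<^sub>1 \<union> T\<^sub>2" if v: "v \<in> C \<union> Y \<union> Z" for v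
    proof -
      consider "v \<in> Y" | "v \<in> Z" | "v \<in> C" using v by blast
      then show ?thesis
      proof cases
        case 3
        have "inj (\<rho> v)"
        proof (rule injI)
          fix x y assume *: "\<rho> v x = \<rho> v y"
          have "inj (\<rho>\<^sub>1 v)" "inj (\<rho>\<^sub>2 v)" using 3 p1 p2 by (auto intro: permutes_inj)
          moreover have "x \<in> T\<^sub>1 \<longleftrightarrow> y \<in> T\<^sub>1" using * Cin1[OF 3] by metis
          ultimately show "x = y" using * 3 by (auto simp: C inj_eq split: if_splits)
        qed
        moreover have "\<rho> v ` (T\<^sub>1 \<union> T\<^sub>2) \<subseteq> T\<^sub>1 \<union> T\<^sub>2" using Cin1[OF 3] Cin2[OF 3] by blast
        ultimately have "bij_betw (\<rho> v) (T\<^sub>1 \<union> T\<^sub>2) (T\<^sub>1 \<union> T\<^sub>2)"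
          using fin by (simp add: bij_betw_def endo_inj_surj inj_on_subset[of _ UNIV])
        then show ?thesis using Cout[OF 3] by (intro bij_imp_permutes) auto
      qed (use p1 p2 Y Z in \<open>auto intro: permutes_subset\<close>)
    qed
    \<comment> \<open>Off \<open>T\<^sub>1\<close> the vertex \<open>y\<close> acts trivially, and
      \<open>c\<close> preserves the complement of \<open>T\<^sub>1\<close>; only points of
      \<open>T\<^sub>1\<close> need the commutation of \<open>\<rho>\<^sub>1\<close>. The same holds
      for \<open>Z\<close> and \<open>T\<^sub>2\<close>.\<close>
    have CY: "\<rho> c (\<rho> y x) = \<rho> y (\<rho> c x)" if "c \<in> C" "y \<in> Y" "\<rho>\<^sub>1 c (\<rho>\<^sub>1 y x) = \<rho>\<^sub>1 y (\<rho>\<^sub>1 c x)" for c y x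
      using that in1[of y x] C1[of c] Y[of y] out1[of y] Cin1[of c x] by (cases "x \<in> T\<^sub>1") auto
    have CZ: "\<rho> c (\<rho> z x) = \<rho> z (\<rho> c x)" if "c \<in> C" "z \<in> Z" "\<rho>\<^sub>2 c (\<rho>\<^sub>2 z x) = \<rho>\<^sub>2 z (\<rho>\<^sub>2 c x)" for c z x
      using that in2[of z x] C2[of c] Z[of z] out2[of z] Cin2[of c x] by (cases "x \<in> T\<^sub>2") auto
    have "\<rho> u (\<rho> v x) = \<rho> v (\<rho> u x)"
      if uv: "u \<in> C \<union> Y \<union> Z" "v \<in> C \<union> Y \<union> Z" "adj u v" for u v x
    proof -
      have 1: "\<rho>\<^sub>1 u (\<rho>\<^sub>1 v x) = \<rho>\<^sub>1 v (\<rho>\<^sub>1 u x)" if "u \<in> C \<union> Y" "v \<in> C \<union> Y"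
        using commuting_permsD(2)[OF act1 that uv(3)] .
      have 2: "\<rho>\<^sub>2 u (\<rho>\<^sub>2 v x) = \<rho>\<^sub>2 v (\<rho>\<^sub>2 u x)" if "u \<in> C \<union> Z" "v \<in> C \<union> Z"
        using commuting_permsD(2)[OF act2 that uv(3)] .
      consider "u \<in> C" "v \<in> C" | "u \<in> C" "v \<in> Y" | "u \<in> Y" "v \<in> C" | "u \<in> C" "v \<in> Z" | "u \<in> Z" "v \<in> C"
        | "u \<in> Y" "v \<in> Y" | "u \<in> Z" "v \<in> Z"
        using uv nonadj by blast
      then show ?thesis
      proof cases
        case 1
        then show ?thesis
          using \<open>\<lbrakk>u \<in> C \<union> Y; v \<in> C \<union> Y\<rbrakk> \<Longrightarrow> _\<close> 2 Cin1[of u x] Cin1[of v x] by (simp add: C)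
      qed (use 1 2 CY[of u v x] CY[of v u x] CZ[of u v x] CZ[of v u x] Y Z in auto)
    qed
    then show "commuting_perms (C \<union> Y \<union> Z) adj (T\<^sub>1 \<union> T\<^sub>2) \<rho>"
      using perm by (intro commuting_permsI)
  qed
qed

text \<open>
  Makes the extension obtained for \<open>C \<union> Z\<close> meet the one for \<open>C \<union> Y\<close> in \<open>S\<close> only.
\<close>

lemma relocating_involution:
  fixes T :: "'b set"
  assumes "infinite (UNIV :: 'b set)" "finite T" "finite B" "S \<subseteq> T"
  obtains \<pi> where "\<And>x. \<pi> (\<pi> x) = x" "\<And>s. s \<in> S \<Longrightarrow> \<pi> s = s" "\<pi> ` (T - S) \<inter> B = {}"
proof -
  have "infinite (UNIV - (T \<union> B))" using assms by (simp add: Diff_infinite_finite)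
  from infinite_arbitrarily_large[OF this, of "card (T - S)"]
  obtain F where F: "F \<subseteq> UNIV - (T \<union> B)" "finite F" "card F = card (T - S)" by auto
  then obtain h where h: "bij_betw h (T - S) F"
    using assms by (metis finite_Diff finite_same_card_bij)
  define k where "k = the_inv_into (T - S) h"
  have k: "bij_betw k F (T - S)" "\<And>x. x \<in> T - S \<Longrightarrow> k (h x) = x" "\<And>y. y \<in> F \<Longrightarrow> h (k y) = y"
    using h bij_betw_the_inv_into[OF h] unfolding k_def
    by (simp_all add: the_inv_into_f_f f_the_inv_into_f bij_betw_def)
  \<comment> \<open>Exchanges \<open>T - S\<close> with the fresh points \<open>F\<close>; being its
    own inverse, \<open>\<pi>\<close> can stand on both sides of a conjugation.\<close>
  define \<pi> where "\<pi> x = (if x \<in> T - S then h x else if x \<in> F then k x else x)" for x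
  have hF: "h x \<in> F" if "x \<in> T - S" for x using h that by (auto simp: bij_betw_def)
  have kT: "k x \<in> T - S" if "x \<in> F" for x using k(1) that by (auto simp: bij_betw_def)
  show ?thesis
  proof
    show "\<pi> (\<pi> x) = x" for x
    proof -
      consider "x \<in> T - S" | "x \<in> F" "x \<notin> T - S" | "x \<notin> F" "x \<notin> T - S" by blast
      then show ?thesis
      proof cases
        case 1
        then have "h x \<in> F" "h x \<notin> T - S" using hF F by blast+
        then show ?thesis using 1 k(2)[OF 1] unfolding \<pi>_def by presburger
      next
        case 2
        then show ?thesis using kT[OF 2(1)] k(3)[OF 2(1)] unfolding \<pi>_def by presburger
      next
        case 3
        then show ?thesis unfolding \<pi>_def by presburger
      qed
    qed
    show "\<pi> s = s" if "s \<in> S" for s using that assms F by (auto simp: \<pi>_def)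
    show "\<pi> ` (T - S) \<inter> B = {}" using hF F by (auto simp: \<pi>_def)
  qed
qed

lemma commuting_perms_conjugate:
  assumes act: "commuting_perms V adj T \<rho>" and inv: "\<And>x. \<pi> (\<pi> x) = x"
  shows "commuting_perms V adj (\<pi> ` T) (\<lambda>v x. \<pi> (\<rho> v (\<pi> x)))"
proof -
  have mem: "\<pi> x \<in> T \<longleftrightarrow> x \<in> \<pi> ` T" for x using inv by (metis image_iff)
  have "(\<lambda>x. \<pi> (\<rho> v (\<pi> x))) permutes \<pi> ` T" if "v \<in> V" for v
  proof -
    have p: "\<rho> v permutes T" using commuting_permsD(1)[OF act that] .
    show ?thesis unfolding permutes_def
    proof (intro conjI allI impI)
      fix x assume "x \<notin> \<pi> ` T"
      then show "\<pi> (\<rho> v (\<pi> x)) = x" using permutes_not_in[OF p] mem inv by metis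
    next
      fix y
      obtain x where x: "\<rho> v x = \<pi> y" using p unfolding permutes_def by metis
      show "\<exists>!x. \<pi> (\<rho> v (\<pi> x)) = y"
      proof (rule ex1I[of _ "\<pi> x"])
        fix x' assume "\<pi> (\<rho> v (\<pi> x')) = y"
        then have "\<rho> v (\<pi> x') = \<rho> v x" using inv x by metis
        then show "x' = \<pi> x" using inv permutes_inj[OF p] by (metis injD)
      qed (simp add: inv x)
    qed
  qed
  then show ?thesis using act inv unfolding commuting_perms_def by (auto simp: fun_eq_iff)
qed

section \<open>The extension property\<close>

text \<open>The infinite type provides fresh points: the extensions for the two parts arise
  independently and may overlap, so one of them is moved until they meet in \<open>S'\<close>
  only.\<close>

lemma finite_extension_infinite_type:
  fixes \<rho> :: "'v \<Rightarrow> 'b \<Rightarrow> 'b"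
  assumes inf: "infinite (UNIV :: 'b set)"
    and sym: "\<And>u v. adj u v \<Longrightarrow> adj v u" and irr: "\<And>v. \<not> adj v v"
    and "finite V" "\<not> obstruction V adj" "commuting_perms V adj UNIV \<rho>" "finite S"
  shows "\<exists>T \<rho>'. finite T \<and> S \<subseteq> T \<and> commuting_perms V adj T \<rho>' \<and> agree_within V S \<rho> \<rho>'"
  using assms(4-7)
proof (induction "card V" arbitrary: V \<rho> S rule: less_induct)
  case less
  define C where "C = {v \<in> V. \<forall>u\<in>V. u \<noteq> v \<longrightarrow> adj v u}"
  have C: "C \<subseteq> V" "finite C" using less.prems by (auto simp: C_def)
  obtain \<rho>1 where \<rho>1: "commuting_perms V adj UNIV \<rho>1" "agree_within V S \<rho> \<rho>1"
    "\<And>c. c \<in> C \<Longrightarrow> \<exists>n>0. \<rho>1 c ^^ n = id"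
    using make_finite_orders[OF less.prems(3) C(2,1) _ less.prems(4)] by (auto simp: C_def)
  have "\<rho>1 c (\<rho>1 d x) = \<rho>1 d (\<rho>1 c x)" if "c \<in> C" "d \<in> C" for c d x
    using that C commuting_permsD(2)[OF \<rho>1(1), of c d] by (cases "c = d") (auto simp: C_def)
  from finite_invariant_superset[OF C(2) this \<rho>1(3) less.prems(4)]
  obtain S' where "finite S' \<and> S \<subseteq> S' \<and> (\<forall>c\<in>C. \<rho>1 c ` S' \<subseteq> S')" ..
  then have S': "finite S'" "S \<subseteq> S'" "\<And>c. c \<in> C \<Longrightarrow> \<rho>1 c ` S' \<subseteq> S'" by auto
  \<comment> \<open>It suffices to extend \<open>\<rho>1\<close> over \<open>S'\<close>: agreement
    within the larger set restricts to \<open>S\<close>.\<close>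
  have *: ?case if "finite T" "S' \<subseteq> T" "commuting_perms V adj T \<rho>'" "agree_within V S' \<rho>1 \<rho>'" for T \<rho>'
  proof -
    have "agree_within V S \<rho>1 \<rho>'" using that(4) S'(2) by (auto simp: agree_within_def)
    then show ?thesis using that S'(2) agree_within_trans[OF \<rho>1(2)] by blast
  qed
  show ?case
  proof (cases "V = C")
    case True
    \<comment> \<open>In a complete graph every vertex is central, so \<open>S'\<close> is already
      invariant and the action is just restricted to it.\<close>
    define \<rho>' where "\<rho>' v x = (if x \<in> S' then \<rho>1 v x else x)" for v x
    have "\<rho>' v permutes S'" if "v \<in> V" for v
    proof (rule bij_imp_permutes)
      have inj: "inj (\<rho>1 v)" using commuting_permsD(1)[OF \<rho>1(1) that] by (rule permutes_inj)
      then have "\<rho>1 v ` S' = S'"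
        using S' that True by (intro endo_inj_surj) (auto intro: inj_on_subset)
      then have "bij_betw (\<rho>1 v) S' S'" using inj by (auto simp: bij_betw_def intro: inj_on_subset)
      moreover have "bij_betw (\<rho>1 v) S' S' \<longleftrightarrow> bij_betw (\<rho>' v) S' S'"
        by (rule bij_betw_cong) (simp add: \<rho>'_def)
      ultimately show "bij_betw (\<rho>' v) S' S'" by blast
    qed (simp add: \<rho>'_def)
    moreover have "\<rho>' u (\<rho>' v x) = \<rho>' v (\<rho>' u x)" if "u \<in> V" "v \<in> V" "adj u v" for u v x
      using S'(3)[of u] S'(3)[of v] True that commuting_permsD(2)[OF \<rho>1(1) that]
      by (simp add: \<rho>'_def image_subset_iff)
    ultimately have "commuting_perms V adj S' \<rho>'" by (intro commuting_permsI)
    moreover have "agree_within V S' \<rho>1 \<rho>'" by (simp add: agree_within_def \<rho>'_def)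
    ultimately show ?thesis using * S' by blast
  next
    case False
    from split_off_dominating[OF less.prems(1) sym irr less.prems(2) C_def False]
    obtain Y Z where YZ: "V = C \<union> Y \<union> Z" "Y \<inter> Z = {}" "C \<inter> Y = {}" "C \<inter> Z = {}" "Y \<noteq> {}" "Z \<noteq> {}"
      "\<And>y z. y \<in> Y \<Longrightarrow> z \<in> Z \<Longrightarrow> \<not> adj y z" by metis
    have IH: "\<exists>T \<rho>'. finite T \<and> S' \<subseteq> T \<and> commuting_perms W adj T \<rho>' \<and> agree_within W S' \<rho>1 \<rho>'"
      if "W \<subset> V" for W
    proof (rule less.hyps)
      show "card W < card V" using that less.prems(1) by (simp add: psubset_card_mono)
      show "finite W" using that less.prems(1) finite_subset by blast
      show "\<not> obstruction W adj" using that less.prems(2) unfolding obstruction_def by blast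
      show "commuting_perms W adj UNIV \<rho>1" using that \<rho>1(1) commuting_perms_subset by blast
    qed (rule S')
    have sub: "C \<union> Y \<subset> V" "C \<union> Z \<subset> V" using YZ by blast+
    obtain T1 \<sigma>1 where T1: "finite T1" "S' \<subseteq> T1" "commuting_perms (C \<union> Y) adj T1 \<sigma>1"
      "agree_within (C \<union> Y) S' \<rho>1 \<sigma>1"
      using IH[OF sub(1)] by blast
    obtain T2 \<sigma>2 where T2: "finite T2" "S' \<subseteq> T2" "commuting_perms (C \<union> Z) adj T2 \<sigma>2"
      "agree_within (C \<union> Z) S' \<rho>1 \<sigma>2"
      using IH[OF sub(2)] by blast
    obtain \<pi> where \<pi>: "\<And>x. \<pi> (\<pi> x) = x" "\<And>s. s \<in> S' \<Longrightarrow> \<pi> s = s" "\<pi> ` (T2 - S') \<inter> T1 = {}"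
      using relocating_involution[OF inf T2(1) T1(1) T2(2)] by blast
    define \<sigma>2' where "\<sigma>2' v x = \<pi> (\<sigma>2 v (\<pi> x))" for v x
    have act2: "commuting_perms (C \<union> Z) adj (\<pi> ` T2) \<sigma>2'"
      using commuting_perms_conjugate[OF T2(3) \<pi>(1)] by (simp add: \<sigma>2'_def[abs_def])
    have inter: "T1 \<inter> \<pi> ` T2 = S'"
    proof -
      have "\<pi> ` S' = S'" using \<pi>(2) by simp
      then have "\<pi> ` T2 = S' \<union> \<pi> ` (T2 - S')" using T2(2) by blast
      then show ?thesis using \<pi>(3) T1(2) by blast
    qed
    have agree1: "\<sigma>1 v s = \<rho>1 v s" if "v \<in> C \<union> Y" "s \<in> S'" "\<rho>1 v s \<in> S'" for v s
      using that T1(4) by (simp add: agree_within_def)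
    have agree2: "\<sigma>2' v s = \<rho>1 v s" if "v \<in> C \<union> Z" "s \<in> S'" "\<rho>1 v s \<in> S'" for v s
      using that T2(4) \<pi>(2) by (simp add: agree_within_def \<sigma>2'_def)
    \<comment> \<open>As \<open>C\<close> preserves \<open>S'\<close>, agreement within
      \<open>S'\<close> becomes equality at every point of \<open>S'\<close>, which is the
      compatibility needed for gluing.\<close>
    have "\<sigma>1 c s = \<sigma>2' c s" if "c \<in> C" "s \<in> T1 \<inter> \<pi> ` T2" for c s
      using that agree1[of c s] agree2[of c s] S'(3)[OF that(1)] unfolding inter by (simp add: image_subset_iff)
    from glue_perms[OF T1(3) act2 T1(1) _ this YZ(2,3,4)]
    obtain \<rho>' where \<rho>': "commuting_perms (C \<union> Y \<union> Z) adj (T1 \<union> \<pi> ` T2) \<rho>'"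
      "\<And>v x. v \<in> C \<union> Y \<Longrightarrow> x \<in> T1 \<Longrightarrow> \<rho>' v x = \<sigma>1 v x"
      "\<And>v x. v \<in> C \<union> Z \<Longrightarrow> x \<in> \<pi> ` T2 \<Longrightarrow> \<rho>' v x = \<sigma>2' v x"
      using YZ(7) T2(1) sym by (metis finite_imageI)
    have "agree_within V S' \<rho>1 \<rho>'"
      unfolding agree_within_def
    proof (intro ballI impI)
      fix v s assume vs: "v \<in> V" "s \<in> S'" "\<rho>1 v s \<in> S'"
      have "s \<in> T1" "s \<in> \<pi> ` T2" using vs inter by blast+
      then show "\<rho>' v s = \<rho>1 v s" using vs \<rho>'(2,3) agree1 agree2 YZ(1) by (metis UnE UnI1 UnI2)
    qed
    then show ?thesis
      using * \<rho>'(1) T1(1,2) T2(1) YZ(1) by (metis finite_UnI finite_imageI le_supI1)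
  qed
qed

text \<open>Over a finite type the given action is its own finite extension, so the infinite case
  carries all the content.\<close>

lemma finite_extension:
  fixes \<rho> :: "'v \<Rightarrow> 'b \<Rightarrow> 'b"
  assumes "\<And>u v. adj u v \<Longrightarrow> adj v u" and "\<And>v. \<not> adj v v"
    and "finite V" "\<not> obstruction V adj" "commuting_perms V adj UNIV \<rho>" "finite S"
  obtains T \<rho>' where "finite T" "S \<subseteq> T" "commuting_perms V adj T \<rho>'" "agree_within V S \<rho> \<rho>'"
proof (cases "finite (UNIV :: 'b set)")
  case True
  show ?thesis by (rule that[OF True _ assms(5)]) (simp_all add: agree_within_def)
next
  case False
  show ?thesis using finite_extension_infinite_type[OF False assms] that by blast
qed

section \<open>Homomorphisms from right-angled Artin groups\<close>

definition perm_group :: "'b set \<Rightarrow> ('b \<Rightarrow> 'b) monoid" where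
  "perm_group T = \<lparr>carrier = {p. p permutes T}, monoid.mult = (\<circ>), monoid.one = id\<rparr>"

lemma perm_group_simps [simp]:
  "p \<in> carrier (perm_group T) \<longleftrightarrow> p permutes T"
  "p \<otimes>\<^bsub>perm_group T\<^esub> q = p \<circ> q"
  "\<one>\<^bsub>perm_group T\<^esub> = id"
  by (simp_all add: perm_group_def)

lemma group_perm_group: "group (perm_group T)"
proof (rule groupI)
  fix p assume "p \<in> carrier (perm_group T)"
  then show "\<exists>q\<in>carrier (perm_group T). q \<otimes>\<^bsub>perm_group T\<^esub> p = \<one>\<^bsub>perm_group T\<^esub>"
    using permutes_inv permutes_inv_o(2) by (metis perm_group_simps)
qed (auto intro: permutes_compose permutes_id simp: comp_assoc)

lemma inv_perm_group: "p permutes T \<Longrightarrow> inv\<^bsub>perm_group T\<^esub> p = inv_into UNIV p"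
  by (rule group.inv_equality[OF group_perm_group]) (simp_all add: permutes_inv_o permutes_inv)

lemma finite_perm_group: "finite T \<Longrightarrow> finite (carrier (perm_group T))"
  by (simp add: perm_group_def finite_permutations)

fun word_eval :: "('g, 'm) monoid_scheme \<Rightarrow> ('s \<Rightarrow> 'g) \<Rightarrow> 's group_word \<Rightarrow> 'g" where
  "word_eval K f [] = \<one>\<^bsub>K\<^esub>"
| "word_eval K f ((s, b) # w) = (if b then f s else inv\<^bsub>K\<^esub> f s) \<otimes>\<^bsub>K\<^esub> word_eval K f w"

lemma group_words_simps [simp]:
  "[] \<in> group_words S" "(s, b) # w \<in> group_words S \<longleftrightarrow> s \<in> S \<and> w \<in> group_words S"
  by (auto simp: group_words_def)

context group begin

lemma word_eval_closed:
  assumes "f \<in> S \<rightarrow> carrier G"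
  shows "w \<in> group_words S \<Longrightarrow> word_eval G f w \<in> carrier G"
  using assms by (induction w) (auto simp: Pi_iff)

lemma word_eval_append:
  assumes "f \<in> S \<rightarrow> carrier G"
  shows "u \<in> group_words S \<Longrightarrow> v \<in> group_words S \<Longrightarrow> word_eval G f (u @ v) = word_eval G f u \<otimes> word_eval G f v"
  using assms word_eval_closed[OF assms] by (induction u) (auto simp: m_assoc Pi_iff)

lemma word_eval_presentation_eq:
  assumes f: "f \<in> S \<rightarrow> carrier G" and R: "\<And>r. r \<in> R \<Longrightarrow> r \<in> group_words S \<Longrightarrow> word_eval G f r = \<one>"
    and "presentation_eq S R u v"
  shows "word_eval G f u = word_eval G f v"
  using assms(3)
proof (induction rule: presentation_eq.induct)
  case (cong u u' v v')
  then show ?case using word_eval_append[OF f] presentation_eq_words by metis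
next
  case (cancel s b)
  then have "f s \<in> carrier G" using f by blast
  then show ?case by (cases b) auto
qed (simp_all add: R)

end

text \<open>Von Dyck's theorem: evaluation respects the congruence, so the word chosen from a class
  does not matter.\<close>

lemma presented_group_hom:
  assumes K: "group K" and f: "f \<in> S \<rightarrow> carrier K"
    and R: "\<And>r. r \<in> R \<Longrightarrow> r \<in> group_words S \<Longrightarrow> word_eval K f r = \<one>\<^bsub>K\<^esub>"
  obtains \<phi> where "\<phi> \<in> hom (presented_group S R) K"
    "\<And>w. w \<in> group_words S \<Longrightarrow> \<phi> (presentation_rel S R `` {w}) = word_eval K f w"
proof -
  interpret K: group K by fact
  define \<phi> where "\<phi> A = word_eval K f (SOME w. w \<in> A)" for A
  have \<phi>: "\<phi> (presentation_rel S R `` {w}) = word_eval K f w" if "w \<in> group_words S" for w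
  proof -
    have "w \<in> presentation_rel S R `` {w}"
      using that by (simp add: presentation_rel_def presentation_eq.refl)
    then have "(SOME u. u \<in> presentation_rel S R `` {w}) \<in> presentation_rel S R `` {w}" by (rule someI)
    then have "presentation_eq S R w (SOME u. u \<in> presentation_rel S R `` {w})"
      by (simp add: presentation_rel_def)
    then show ?thesis unfolding \<phi>_def using K.word_eval_presentation_eq[OF f R] by metis
  qed
  have "\<phi> \<in> hom (presented_group S R) K"
  proof (rule homI)
    fix A assume "A \<in> carrier (presented_group S R)"
    then obtain u where u: "u \<in> group_words S" "A = presentation_rel S R `` {u}"
      using carrier_presented_group by blast
    then show "\<phi> A \<in> carrier K" using \<phi> K.word_eval_closed[OF f] by simp
    fix B assume "B \<in> carrier (presented_group S R)"
    then obtain v where v: "v \<in> group_words S" "B = presentation_rel S R `` {v}"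
      using carrier_presented_group by blast
    have "u @ v \<in> group_words S" using u v by (simp add: group_words_def)
    then show "\<phi> (A \<otimes>\<^bsub>presented_group S R\<^esub> B) = \<phi> A \<otimes>\<^bsub>K\<^esub> \<phi> B"
      using u v \<phi> K.word_eval_append[OF f] by (simp add: presented_group_mult)
  qed
  then show ?thesis using that \<phi> by blast
qed

definition raag_gen :: "('v, 'e) pre_digraph \<Rightarrow> 'v \<Rightarrow> 'v group_word set" where
  "raag_gen X v = presentation_rel (verts X) {commutator_word u v |u v. u \<rightarrow>\<^bsub>X\<^esub> v} `` {[(v, True)]}"

lemma group_raag: "group (raag X)"
  by (simp add: raag_def group_presented_group)

lemma raag_gen_closed: "v \<in> verts X \<Longrightarrow> raag_gen X v \<in> carrier (raag X)"
  unfolding raag_gen_def raag_def carrier_presented_group by (intro bexI[of _ "[(v, True)]"]) simp_all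

text \<open>Bridge from equivalence classes to products of generators, through which group elements
  are spelled out later.\<close>

lemma raag_class_eq_word_eval:
  fixes X :: "('v, 'e) pre_digraph"
  defines "R \<equiv> {commutator_word u v |u v. u \<rightarrow>\<^bsub>X\<^esub> v}"
  shows "w \<in> group_words (verts X) \<Longrightarrow>
    presentation_rel (verts X) R `` {w} = word_eval (raag X) (raag_gen X) w"
proof (induction w)
  case Nil
  then show ?case by (simp add: raag_def presented_group_def R_def)
next
  case (Cons x w)
  interpret G: group "raag X" by (rule group_raag)
  obtain s b where x: "x = (s, b)" by (cases x)
  let ?c = "\<lambda>w. presentation_rel (verts X) R `` {w}"
  have G: "raag X = presented_group (verts X) R" by (simp add: raag_def R_def)
  have s: "s \<in> verts X" and w: "w \<in> group_words (verts X)" using Cons.prems x by simp_all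
  have "?c [(s, False)] = inv\<^bsub>raag X\<^esub> raag_gen X s"
  proof (rule G.inv_equality[symmetric])
    have "presentation_eq (verts X) R [(s, False), (s, True)] []"
      using presentation_eq.cancel[OF s, of R False] by simp
    then have "?c [(s, False), (s, True)] = ?c []"
      by (intro equiv_class_eq[OF equiv_presentation_rel]) (simp add: presentation_rel_def)
    then show "?c [(s, False)] \<otimes>\<^bsub>raag X\<^esub> raag_gen X s = \<one>\<^bsub>raag X\<^esub>"
      using s by (simp add: raag_gen_def G presented_group_mult flip: R_def)
        (simp add: presented_group_def)
    show "raag_gen X s \<in> carrier (raag X)" using s by (rule raag_gen_closed)
    show "?c [(s, False)] \<in> carrier (raag X)"
      unfolding G carrier_presented_group using s by (intro bexI[of _ "[(s, False)]"]) simp_all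
  qed
  then have "?c [(s, b)] = (if b then raag_gen X s else inv\<^bsub>raag X\<^esub> raag_gen X s)"
    by (simp add: raag_gen_def R_def)
  moreover have "?c (x # w) = ?c [(s, b)] \<otimes>\<^bsub>raag X\<^esub> ?c w"
    using s w x by (simp add: G presented_group_mult)
  ultimately show ?case using Cons.IH[OF w] x by simp
qed

lemma raag_carrier_word_eval:
  assumes "x \<in> carrier (raag X)"
  obtains w where "w \<in> group_words (verts X)" "x = word_eval (raag X) (raag_gen X) w"
proof -
  let ?R = "{commutator_word u v |u v. u \<rightarrow>\<^bsub>X\<^esub> v}"
  obtain w where "w \<in> group_words (verts X)" "x = presentation_rel (verts X) ?R `` {w}"
    using assms unfolding raag_def carrier_presented_group by (elim bexE)
  then show thesis using that raag_class_eq_word_eval[of w X] by simp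
qed

lemma (in wf_digraph) raag_gen_commute:
  assumes "u \<rightarrow>\<^bsub>G\<^esub> v"
  shows "raag_gen G u \<otimes>\<^bsub>raag G\<^esub> raag_gen G v = raag_gen G v \<otimes>\<^bsub>raag G\<^esub> raag_gen G u"
proof -
  let ?A = "raag G" and ?R = "{commutator_word u v |u v. u \<rightarrow>\<^bsub>G\<^esub> v}"
  interpret A: group ?A by (rule group_raag)
  have uv: "u \<in> verts G" "v \<in> verts G" using assms by (auto dest: adj_in_verts)
  then have gen: "raag_gen G u \<in> carrier ?A" "raag_gen G v \<in> carrier ?A" by (auto intro: raag_gen_closed)
  have c: "commutator_word u v \<in> group_words (verts G)" using uv by (simp add: commutator_word_def)
  then have "presentation_eq (verts G) ?R (commutator_word u v) []"
    using assms by (intro presentation_eq.relator) auto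
  then have "presentation_rel (verts G) ?R `` {commutator_word u v} = presentation_rel (verts G) ?R `` {[]}"
    by (intro equiv_class_eq[OF equiv_presentation_rel]) (simp add: presentation_rel_def)
  then have "word_eval ?A (raag_gen G) (commutator_word u v) = \<one>\<^bsub>?A\<^esub>"
    using raag_class_eq_word_eval[OF c] raag_class_eq_word_eval[of "[]" G] by simp
  then have "raag_gen G u \<otimes>\<^bsub>?A\<^esub> raag_gen G v \<otimes>\<^bsub>?A\<^esub> inv\<^bsub>?A\<^esub> (raag_gen G v \<otimes>\<^bsub>?A\<^esub> raag_gen G u) = \<one>\<^bsub>?A\<^esub>"
    using gen by (simp add: commutator_word_def A.inv_mult_group A.m_assoc)
  then show ?thesis using gen A.inv_equality A.inv_inv A.m_closed A.inv_closed by metis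
qed

text \<open>Universal property of the group: commutation along edges makes every commutator relator
  evaluate to one.\<close>

lemma raag_hom:
  assumes K: "group K" and f: "f \<in> verts X \<rightarrow> carrier K"
    and comm: "\<And>u v. u \<in> verts X \<Longrightarrow> v \<in> verts X \<Longrightarrow> u \<rightarrow>\<^bsub>X\<^esub> v \<Longrightarrow> f u \<otimes>\<^bsub>K\<^esub> f v = f v \<otimes>\<^bsub>K\<^esub> f u"
  obtains \<phi> where "\<phi> \<in> hom (raag X) K" "\<And>v. v \<in> verts X \<Longrightarrow> \<phi> (raag_gen X v) = f v"
proof -
  interpret K: group K by fact
  have "word_eval K f r = \<one>\<^bsub>K\<^esub>"
    if rel: "r \<in> {commutator_word u v |u v. u \<rightarrow>\<^bsub>X\<^esub> v}" and words: "r \<in> group_words (verts X)" for r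
  proof -
    obtain u v where r: "r = commutator_word u v" "u \<rightarrow>\<^bsub>X\<^esub> v" using rel by blast
    then have uv: "u \<in> verts X" "v \<in> verts X" using words by (simp_all add: commutator_word_def)
    then have "f u \<in> carrier K" "f v \<in> carrier K" using f by blast+
    moreover from this have "f u \<otimes>\<^bsub>K\<^esub> f v \<otimes>\<^bsub>K\<^esub> inv\<^bsub>K\<^esub> (f v \<otimes>\<^bsub>K\<^esub> f u) = \<one>\<^bsub>K\<^esub>"
      by (simp add: comm[OF uv r(2)])
    ultimately show ?thesis
      unfolding r(1) by (simp add: commutator_word_def K.inv_mult_group K.m_assoc)
  qed
  from presented_group_hom[OF K f this]
  obtain \<phi> where \<phi>: "\<phi> \<in> hom (raag X) K"
    "\<And>w. w \<in> group_words (verts X) \<Longrightarrow>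
      \<phi> (presentation_rel (verts X) {commutator_word u v |u v. u \<rightarrow>\<^bsub>X\<^esub> v} `` {w}) = word_eval K f w"
    unfolding raag_def by blast
  have "\<phi> (raag_gen X v) = f v" if v: "v \<in> verts X" for v
  proof -
    have "f v \<in> carrier K" using f v by blast
    then show ?thesis using \<phi>(2)[of "[(v, True)]"] v by (simp add: raag_gen_def)
  qed
  then show ?thesis using that \<phi>(1) by blast
qed

text \<open>The quotient by the kernel embeds into the finite target.\<close>

lemma (in group_hom) finite_index_normal_kernel:
  assumes "finite (carrier H)"
  shows "finite_index_normal (kernel G H h) G"
proof -
  have "(\<lambda>X. the_elem (h ` X)) ` carrier (G Mod kernel G H h) \<subseteq> carrier H"
    using FactGroup_hom by (auto simp: hom_def)
  then have "finite (carrier (G Mod kernel G H h))"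
    using assms FactGroup_inj_on finite_imageD finite_subset by blast
  then show ?thesis using normal_kernel by (simp add: finite_index_normal_def FactGroup_def)
qed

lemma stabilizer_subgroup:
  fixes G (structure)
  assumes "group G" and hom: "\<phi> \<in> hom G (perm_group T)"
  shows "subgroup {g \<in> carrier G. \<phi> g p = p} G"
proof -
  interpret group G by fact
  interpret K: group "perm_group T" by (rule group_perm_group)
  interpret group_hom G "perm_group T" \<phi> by unfold_locales (rule hom)
  show ?thesis
  proof (rule subgroupI)
    show "inv a \<in> {g \<in> carrier G. \<phi> g p = p}" if "a \<in> {g \<in> carrier G. \<phi> g p = p}" for a
    proof -
      have "a \<in> carrier G" "\<phi> a p = p" "\<phi> a permutes T" using that hom_closed[of a] by auto
      then show ?thesis by (simp add: inv_perm_group permutes_inv_eq)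
    qed
  qed (auto intro!: exI[of _ "\<one>"])
qed

text \<open>Turns membership of a quotient of two words in a stabilizer into a comparison of two
  image points, which can be computed in the concrete representations below.\<close>

lemma hom_inv_mult_fixes_iff:
  fixes G (structure)
  assumes "group G" and hom: "\<phi> \<in> hom G (perm_group T)" and gh: "g \<in> carrier G" "h \<in> carrier G"
  shows "\<phi> (inv\<^bsub>G\<^esub> h \<otimes>\<^bsub>G\<^esub> g) p = p \<longleftrightarrow> \<phi> g p = \<phi> h p"
proof -
  interpret group G by fact
  interpret K: group "perm_group T" by (rule group_perm_group)
  interpret group_hom G "perm_group T" \<phi> by unfold_locales (rule hom)
  have "\<phi> h permutes T" using hom_closed gh by simp
  then show ?thesis using gh permutes_inv_eq[of "\<phi> h" T "\<phi> g p" p] by (auto simp: inv_perm_group)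
qed

section \<open>Separability in the absence of obstructions\<close>

text \<open>The default branch makes left translation a permutation of the whole type of sets, as
  the extension property requires; cosets of a subgroup are permuted among themselves.\<close>

definition lmult :: "('g, 'm) monoid_scheme \<Rightarrow> 'g \<Rightarrow> 'g set \<Rightarrow> 'g set" where
  "lmult G x Q = (if Q \<subseteq> carrier G then x <#\<^bsub>G\<^esub> Q else Q)"

context group begin

lemma lmult_mult:
  assumes "x \<in> carrier G" "y \<in> carrier G"
  shows "lmult G x (lmult G y Q) = lmult G (x \<otimes> y) Q"
  using assms lcos_m_assoc l_coset_subset_G by (simp add: lmult_def)

lemma lmult_one: "lmult G \<one> Q = Q"
  by (simp add: lmult_def lcos_mult_one)

lemma lmult_permutes:
  assumes "x \<in> carrier G"
  shows "lmult G x permutes UNIV"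
proof -
  have "bij (lmult G x)"
    by (rule o_bij[of "lmult G (inv x)"]) (use assms in \<open>simp_all add: fun_eq_iff lmult_mult lmult_one\<close>)
  then show ?thesis by (rule bij_imp_permutes) simp
qed

lemma lmult_subgroup_eq_iff:
  assumes H: "subgroup H G" and x: "x \<in> carrier G"
  shows "lmult G x H = H \<longleftrightarrow> x \<in> H"
proof
  interpret H: subgroup H G by fact
  assume "lmult G x H = H"
  then have "x <# H = H" using H.subset by (simp add: lmult_def)
  moreover have "x \<otimes> \<one> \<in> x <# H" using H.one_closed unfolding l_coset_def by blast
  ultimately show "x \<in> H" using x by simp
next
  assume "x \<in> H"
  then show "lmult G x H = H"
    using H coset_join3 x subgroup.subset by (metis lmult_def)
qed

end

lemma raag_subgroup_separable:
  fixes X :: "('v, 'e) pre_digraph"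
  assumes "graph X" and no: "\<not> obstruction (verts X) (\<lambda>u v. u \<rightarrow>\<^bsub>X\<^esub> v)"
  shows "subgroup_separable (raag X)"
  unfolding subgroup_separable_def
proof (intro allI impI)
  interpret X: graph X by fact
  define G where "G = raag X"
  interpret G: group G by (simp add: G_def group_raag)
  fix H assume "finitely_generated_subgroup H (raag X)"
  then obtain A where A: "finite A" "A \<subseteq> carrier G" "H = generate G A"
    by (auto simp: finitely_generated_subgroup_def G_def)
  have H: "subgroup H G" using A G.generate_is_subgroup by simp
  have separate: "\<exists>N. finite_index_normal N G \<and> x \<notin> H <#>\<^bsub>G\<^esub> N" if x: "x \<in> carrier G" "x \<notin> H" for x
  proof -
    let ?g = "raag_gen X"
    have gen: "?g \<in> verts X \<rightarrow> carrier G" using raag_gen_closed by (auto simp: G_def)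
    have "\<exists>w. w \<in> group_words (verts X) \<and> y = word_eval G ?g w" if "y \<in> carrier G" for y
      using raag_carrier_word_eval[of y X] that by (auto simp: G_def)
    then obtain W where W: "\<And>y. y \<in> carrier G \<Longrightarrow> W y \<in> group_words (verts X)"
      "\<And>y. y \<in> carrier G \<Longrightarrow> word_eval G ?g (W y) = y" by metis
    \<comment> \<open>Words act from their last letter on, so the points visited are given by
      suffixes, from the empty one (the coset \<open>H\<close>) to the full word. Including
      \<open>x\<close> makes its effect on \<open>H\<close> visible in the finite action.\<close>
    define S where "S = (\<Union>y\<in>insert x A. (\<lambda>i. lmult G (word_eval G ?g (drop i (W y))) H) ` {..length (W y)})"
    have finS: "finite S" using A by (simp add: S_def)
    have act: "commuting_perms (verts X) (\<lambda>u v. u \<rightarrow>\<^bsub>X\<^esub> v) UNIV (\<lambda>v. lmult G (?g v))"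
    proof (rule commuting_permsI)
      show "lmult G (?g v) permutes UNIV" if "v \<in> verts X" for v
        using gen that by (intro G.lmult_permutes) blast
      show "lmult G (?g u) (lmult G (?g v) Q) = lmult G (?g v) (lmult G (?g u) Q)"
        if "u \<in> verts X" "v \<in> verts X" "u \<rightarrow>\<^bsub>X\<^esub> v" for u v Q
      proof -
        have "?g u \<in> carrier G" "?g v \<in> carrier G" using gen that by blast+
        moreover have "?g u \<otimes>\<^bsub>G\<^esub> ?g v = ?g v \<otimes>\<^bsub>G\<^esub> ?g u"
          unfolding G_def by (rule X.raag_gen_commute[OF that(3)])
        ultimately show ?thesis by (simp add: G.lmult_mult)
      qed
    qed
    obtain T \<rho> where T: "finite T" "S \<subseteq> T" "commuting_perms (verts X) (\<lambda>u v. u \<rightarrow>\<^bsub>X\<^esub> v) T \<rho>"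
      "agree_within (verts X) S (\<lambda>v. lmult G (?g v)) \<rho>"
    proof (rule finite_extension[OF _ _ X.finite_verts no act finS])
      show "u \<rightarrow>\<^bsub>X\<^esub> v \<Longrightarrow> v \<rightarrow>\<^bsub>X\<^esub> u" for u v by (rule X.graph_symmetric)
      show "\<not> v \<rightarrow>\<^bsub>X\<^esub> v" for v using X.adj_not_same by blast
    qed (rule that)
    let ?K = "perm_group T"
    interpret K: group ?K by (rule group_perm_group)
    have \<rho>: "\<rho> \<in> verts X \<rightarrow> carrier ?K" using commuting_permsD(1)[OF T(3)] by simp
    have "\<rho> u \<otimes>\<^bsub>?K\<^esub> \<rho> v = \<rho> v \<otimes>\<^bsub>?K\<^esub> \<rho> u" if "u \<in> verts X" "v \<in> verts X" "u \<rightarrow>\<^bsub>X\<^esub> v" for u v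
      using commuting_permsD(2)[OF T(3) that] by (simp add: fun_eq_iff)
    from raag_hom[OF group_perm_group \<rho> this]
    obtain \<phi> where \<phi>: "\<phi> \<in> hom G ?K" "\<And>v. v \<in> verts X \<Longrightarrow> \<phi> (?g v) = \<rho> v"
      unfolding G_def by blast
    interpret \<phi>: group_hom G ?K \<phi> by unfold_locales (rule \<phi>(1))
    \<comment> \<open>The finite action is only known to agree within \<open>S\<close>; a word all
      of whose suffixes keep \<open>H\<close> in \<open>S\<close> is followed faithfully.\<close>
    have follow: "\<phi> (word_eval G ?g w) H = lmult G (word_eval G ?g w) H"
      if "w \<in> group_words (verts X)" "\<And>i. i \<le> length w \<Longrightarrow> lmult G (word_eval G ?g (drop i w)) H \<in> S" for w
      using that
    proof (induction w)
      case Nil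
      then show ?case using \<phi>.hom_one by (simp add: G.lmult_one)
    next
      case (Cons l w)
      obtain v b where l: "l = (v, b)" by (cases l)
      have v: "v \<in> verts X" and w: "w \<in> group_words (verts X)" using Cons.prems(1) l by simp_all
      have gv: "?g v \<in> carrier G" using gen v by blast
      define y where "y = word_eval G ?g w"
      have y: "y \<in> carrier G" using G.word_eval_closed[OF gen w] by (simp add: y_def)
      have "lmult G (word_eval G ?g (drop i w)) H \<in> S" if "i \<le> length w" for i
        using Cons.prems(2)[of "Suc i"] that by simp
      then have IH: "\<phi> y H = lmult G y H" and yS: "lmult G y H \<in> S"
        using Cons.IH[OF w] unfolding y_def by (blast, metis drop0 le0)
      have pv: "\<rho> v permutes T" using commuting_permsD(1)[OF T(3) v] .
      have agree: "\<rho> v Q = lmult G (?g v) Q" if "Q \<in> S" "lmult G (?g v) Q \<in> S" for Q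
        using T(4) v that by (simp add: agree_within_def)
      have lS: "lmult G (word_eval G ?g (l # w)) H \<in> S" using Cons.prems(2)[of 0] by simp
      show ?case
      proof (cases b)
        case True
        then have *: "word_eval G ?g (l # w) = ?g v \<otimes>\<^bsub>G\<^esub> y" by (simp add: l y_def)
        have "\<phi> (?g v \<otimes>\<^bsub>G\<^esub> y) H = \<rho> v (lmult G y H)" using gv y IH \<phi>(2)[OF v] by simp
        also have "\<dots> = lmult G (?g v) (lmult G y H)"
          using agree[OF yS] lS * gv y by (simp add: G.lmult_mult)
        finally show ?thesis using * gv y by (simp add: G.lmult_mult)
      next
        case False
        then have *: "word_eval G ?g (l # w) = inv\<^bsub>G\<^esub> ?g v \<otimes>\<^bsub>G\<^esub> y" by (simp add: l y_def)
        let ?Q = "lmult G (inv\<^bsub>G\<^esub> ?g v \<otimes>\<^bsub>G\<^esub> y) H"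
        \<comment> \<open>For an inverse letter, agreement is applied backwards: the generator takes
          the new point to the old one, both in \<open>S\<close>, so its inverse permutation goes
          the way wanted.\<close>
        have Q: "lmult G (?g v) ?Q = lmult G y H"
          using gv y by (simp add: G.lmult_mult G.m_assoc[symmetric])
        then have "\<rho> v ?Q = lmult G y H" using agree[of ?Q] yS lS * by simp
        then have "inv_into UNIV (\<rho> v) (lmult G y H) = ?Q" using permutes_inv_eq[OF pv] by blast
        moreover have "\<phi> (inv\<^bsub>G\<^esub> ?g v \<otimes>\<^bsub>G\<^esub> y) H = inv_into UNIV (\<rho> v) (lmult G y H)"
          using gv y IH \<phi>(2)[OF v] inv_perm_group[OF pv] by simp
        ultimately show ?thesis using * by simp
      qed
    qed
    have base: "\<phi> y H = lmult G y H" if "y \<in> insert x A" for y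
    proof -
      have y: "y \<in> carrier G" using that x(1) A(2) by blast
      have "lmult G (word_eval G ?g (drop i (W y))) H \<in> S" if "i \<le> length (W y)" for i
        using that \<open>y \<in> insert x A\<close> unfolding S_def by blast
      then show ?thesis using follow[OF W(1)[OF y]] W(2)[OF y] by simp
    qed
    have "\<phi> a H = H" if a: "a \<in> A" for a
    proof -
      have "a \<in> carrier G" "a \<in> H" using a A by (auto intro: generate.incl)
      then show ?thesis using base a G.lmult_subgroup_eq_iff[OF H] by simp
    qed
    then have "A \<subseteq> {y \<in> carrier G. \<phi> y H = H}" using A(2) by blast
    moreover have "subgroup {y \<in> carrier G. \<phi> y H = H} G"
      by (rule stabilizer_subgroup[OF G.group_axioms \<phi>(1)])
    ultimately have fixH: "\<phi> h H = H" if "h \<in> H" for h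
      using G.generate_subgroup_incl that unfolding A(3) by blast
    \<comment> \<open>An element of \<open>H\<close> times one of the kernel fixes the point
      \<open>H\<close>, whereas \<open>x\<close> moves it.\<close>
    have "x \<notin> H <#>\<^bsub>G\<^esub> kernel G ?K \<phi>"
    proof
      assume "x \<in> H <#>\<^bsub>G\<^esub> kernel G ?K \<phi>"
      then obtain h n where hn: "h \<in> H" "n \<in> carrier G" "\<phi> n = id" "x = h \<otimes>\<^bsub>G\<^esub> n"
        by (auto simp: set_mult_def kernel_def)
      then have "\<phi> x H = H" using fixH H subgroup.mem_carrier[OF H] by simp
      then show False using base[of x] G.lmult_subgroup_eq_iff[OF H x(1)] x(2) by simp
    qed
    then show ?thesis using \<phi>.finite_index_normal_kernel finite_perm_group[OF T(1)] by blast
  qed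
  have "H \<subseteq> H <#>\<^bsub>G\<^esub> N" if N: "finite_index_normal N G" for N
  proof
    fix h assume h: "h \<in> H"
    have "h \<otimes>\<^bsub>G\<^esub> \<one>\<^bsub>G\<^esub> \<in> H <#>\<^bsub>G\<^esub> N"
      using h N normal_imp_subgroup[THEN subgroup.one_closed]
      unfolding finite_index_normal_def set_mult_def by blast
    then show "h \<in> H <#>\<^bsub>G\<^esub> N" using h subgroup.mem_carrier[OF H] by simp
  qed
  moreover have "x \<in> H" if x: "\<And>N. finite_index_normal N G \<Longrightarrow> x \<in> H <#>\<^bsub>G\<^esub> N" for x
  proof (rule ccontr)
    assume "x \<notin> H"
    \<comment> \<open>The whole group is among the finite index normal subgroups and places
      \<open>x\<close> in the carrier, as separation requires.\<close>
    have "carrier G \<lhd> G" by (simp add: G.normal_inv_iff G.subgroup_self)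
    moreover have "rcosets\<^bsub>G\<^esub> carrier G \<subseteq> {carrier G}"
      using G.coset_join2 G.subgroup_self by (auto simp: RCOSETS_def)
    ultimately have "finite_index_normal (carrier G) G"
      by (auto simp: finite_index_normal_def intro: finite_subset)
    then have "x \<in> H <#>\<^bsub>G\<^esub> carrier G" by (rule x)
    then have "x \<in> carrier G" using subgroup.subset[OF H] by (auto simp: set_mult_def)
    then show False using separate[OF _ \<open>x \<notin> H\<close>] x by blast
  qed
  ultimately have "H = (\<Inter>N\<in>{N. finite_index_normal N G}. H <#>\<^bsub>G\<^esub> N)" by blast
  then show "closedin (profinite_topology (raag X)) H"
    using G.closedin_profinite_topology[OF H] by (simp add: G_def)
qed

section \<open>Full paths and squares\<close>

text \<open>Without parallel arcs an arc is determined by its ends, so an isomorphism amounts to its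
  vertex map. Here \<open>f\<close> is the inverse of that map, going from the model into the
  graph.\<close>

lemma (in graph) full_subgraph_iso_undirected_graph:
  assumes E: "E \<subseteq> V \<times> V"
  shows "has_full_subgraph_iso G (undirected_graph V E) \<longleftrightarrow>
    (\<exists>f. inj_on f V \<and> f ` V \<subseteq> verts G \<and> (\<forall>i\<in>V. \<forall>j\<in>V. f i \<rightarrow>\<^bsub>G\<^esub> f j \<longleftrightarrow> (i, j) \<in> E \<union> E\<inverse>))"
    (is "?iso \<longleftrightarrow> (\<exists>f. ?full f)")
proof
  assume ?iso
  then obtain Z h where Z: "induced_subgraph Z G" and h: "pre_digraph.digraph_isomorphism Z h"
    and app: "undirected_graph V E = app_iso h Z"
    by (auto simp: has_full_subgraph_iso_def digraph_iso_def)
  have V: "V = iso_verts h ` verts Z" and arcs: "E \<union> E\<inverse> = iso_arcs h ` arcs Z"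
    and ends: "fst = iso_tail h" "snd = iso_head h"
    using app by (simp_all add: undirected_graph_def with_proj_def app_iso_def)
  have inj: "inj_on (iso_verts h) (verts Z)"
    using h by (simp add: pre_digraph.digraph_isomorphism_def)
  have arc: "iso_arcs h e = (iso_verts h (tail Z e), iso_verts h (head Z e))" if "e \<in> arcs Z" for e
    using h that ends by (simp add: pre_digraph.digraph_isomorphism_def prod_eq_iff)
  have sub: "verts Z \<subseteq> verts G" "tail Z = tail G" "head Z = head G"
    "arcs Z = {e \<in> arcs G. tail G e \<in> verts Z \<and> head G e \<in> verts Z}"
    using Z by (auto simp: induced_subgraph_def subgraph_def compatible_def)
  define f where "f = the_inv_into (verts Z) (iso_verts h)"
  have f: "f (iso_verts h v) = v" if "v \<in> verts Z" for v
    using that inj by (simp add: f_def the_inv_into_f_f)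
  have adj: "u \<rightarrow>\<^bsub>G\<^esub> v \<longleftrightarrow> (iso_verts h u, iso_verts h v) \<in> E \<union> E\<inverse>" if uv: "u \<in> verts Z" "v \<in> verts Z" for u v
  proof
    assume "u \<rightarrow>\<^bsub>G\<^esub> v"
    then obtain e where e: "e \<in> arcs G" "tail G e = u" "head G e = v"
      by (auto simp: arcs_ends_conv)
    then have "e \<in> arcs Z" using sub uv by simp
    then have "iso_arcs h e \<in> E \<union> E\<inverse>" using arcs by blast
    then show "(iso_verts h u, iso_verts h v) \<in> E \<union> E\<inverse>" using arc[OF \<open>e \<in> arcs Z\<close>] e sub by simp
  next
    assume "(iso_verts h u, iso_verts h v) \<in> E \<union> E\<inverse>"
    then obtain e where e: "e \<in> arcs Z" "iso_arcs h e = (iso_verts h u, iso_verts h v)"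
      unfolding arcs by force
    then have "tail Z e = u" "head Z e = v" using arc[OF e(1)] inj uv sub by (auto simp: inj_on_eq_iff)
    then show "u \<rightarrow>\<^bsub>G\<^esub> v" using e sub by (force simp: arcs_ends_conv)
  qed
  have "?full f"
    unfolding V using f adj sub(1) by (auto intro!: inj_onI)
  then show "\<exists>f. ?full f" by blast
next
  assume "\<exists>f. ?full f"
  then obtain f where inj: "inj_on f V" and fV: "f ` V \<subseteq> verts G"
    and adj: "\<And>i j. i \<in> V \<Longrightarrow> j \<in> V \<Longrightarrow> f i \<rightarrow>\<^bsub>G\<^esub> f j \<longleftrightarrow> (i, j) \<in> E \<union> E\<inverse>" by blast
  define g where "g = the_inv_into V f"
  have g: "g (f i) = i" if "i \<in> V" for i using that inj by (simp add: g_def the_inv_into_f_f)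
  define Z where "Z = G \<restriction> f ` V"
  \<comment> \<open>Arcs become pairs of indices; the new end maps are the projections because
    \<open>undirected_graph\<close> is built by \<open>with_proj\<close>.\<close>
  define h where "h = \<lparr>iso_verts = g, iso_arcs = (\<lambda>e. (g (tail G e), g (head G e))),
    iso_head = snd, iso_tail = fst\<rparr>"
  have Z: "verts Z = f ` V" "tail Z = tail G" "head Z = head G"
    "arcs Z = {e \<in> arcs G. tail G e \<in> f ` V \<and> head G e \<in> f ` V}"
    by (simp_all add: Z_def)
  have indu: "induced_subgraph Z G" unfolding Z_def using fV by (rule induced_induce)
  moreover have "pre_digraph.digraph_isomorphism Z h"
    unfolding pre_digraph.digraph_isomorphism_def
  proof (intro conjI ballI)
    show "wf_digraph Z" using indu by (auto simp: induced_subgraph_def subgraph_def)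
    show "inj_on (iso_verts h) (verts Z)" by (auto simp: h_def Z g intro!: inj_onI)
    show "inj_on (iso_arcs h) (arcs Z)"
    proof (rule inj_onI)
      fix e e' assume e: "e \<in> arcs Z" "e' \<in> arcs Z" "iso_arcs h e = iso_arcs h e'"
      then have "tail G e = tail G e'" "head G e = head G e'" by (auto simp: h_def Z g)
      then show "e = e'" using e no_multi_arcs by (auto simp: Z arc_to_ends_def)
    qed
  qed (simp_all add: h_def Z)
  moreover have "undirected_graph V E = app_iso h Z"
  proof -
    have "g ` f ` V = V" using g by force
    moreover have "(\<lambda>e. (g (tail G e), g (head G e))) ` arcs Z = E \<union> E\<inverse>"
    proof
      show "(\<lambda>e. (g (tail G e), g (head G e))) ` arcs Z \<subseteq> E \<union> E\<inverse>"
      proof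
        fix p assume "p \<in> (\<lambda>e. (g (tail G e), g (head G e))) ` arcs Z"
        then obtain e i j where e: "e \<in> arcs G" "tail G e = f i" "head G e = f j" "i \<in> V" "j \<in> V" "p = (i, j)"
          by (auto simp: Z g)
        then have "f i \<rightarrow>\<^bsub>G\<^esub> f j" by (force simp: arcs_ends_conv)
        then show "p \<in> E \<union> E\<inverse>" using adj e by simp
      qed
      show "E \<union> E\<inverse> \<subseteq> (\<lambda>e. (g (tail G e), g (head G e))) ` arcs Z"
      proof
        fix p assume p: "p \<in> E \<union> E\<inverse>"
        obtain i j where ij: "p = (i, j)" by (cases p)
        then have V: "i \<in> V" "j \<in> V" using p E by auto
        then have "f i \<rightarrow>\<^bsub>G\<^esub> f j" using adj p ij by simp
        then obtain e where e: "e \<in> arcs G" "tail G e = f i" "head G e = f j"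
          by (auto simp: arcs_ends_conv)
        then have "e \<in> arcs Z" using V by (simp add: Z)
        moreover have "p = (g (tail G e), g (head G e))" using e V ij g by simp
        ultimately show "p \<in> (\<lambda>e. (g (tail G e), g (head G e))) ` arcs Z" by blast
      qed
    qed
    ultimately show ?thesis
      by (simp add: undirected_graph_def with_proj_def app_iso_def h_def Z)
  qed
  ultimately show ?iso unfolding has_full_subgraph_iso_def digraph_iso_def by blast
qed

text \<open>The flag \<open>cyc\<close> decides the one pair left open by
  \<open>obstruction\<close>: true gives the square, false the path.\<close>

definition path_or_square_in :: "('v, 'e) pre_digraph \<Rightarrow> bool \<Rightarrow> 'v \<Rightarrow> 'v \<Rightarrow> 'v \<Rightarrow> 'v \<Rightarrow> bool" where
  "path_or_square_in X cyc a b c d \<longleftrightarrow> {a, b, c, d} \<subseteq> verts X \<and> distinct [a, b, c, d] \<and>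
    a \<rightarrow>\<^bsub>X\<^esub> b \<and> b \<rightarrow>\<^bsub>X\<^esub> c \<and> c \<rightarrow>\<^bsub>X\<^esub> d \<and> \<not> a \<rightarrow>\<^bsub>X\<^esub> c \<and> \<not> b \<rightarrow>\<^bsub>X\<^esub> d \<and> (a \<rightarrow>\<^bsub>X\<^esub> d \<longleftrightarrow> cyc)"

context graph begin

lemma adj_commute: "u \<rightarrow>\<^bsub>G\<^esub> v \<longleftrightarrow> v \<rightarrow>\<^bsub>G\<^esub> u"
  using graph_symmetric by blast

lemma full_path_or_square_iff:
  assumes E: "E = {(1, 2), (2, 3), (3, 4)} \<union> (if cyc then {(4, 1)} else {})"
  shows "has_full_subgraph_iso G (undirected_graph {1, 2, 3, 4 :: nat} E) \<longleftrightarrow>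
    (\<exists>a b c d. path_or_square_in G cyc a b c d)"
proof -
  let ?V = "{1, 2, 3, 4 :: nat}"
  let ?full = "\<lambda>f. inj_on f ?V \<and> f ` ?V \<subseteq> verts G \<and> (\<forall>i\<in>?V. \<forall>j\<in>?V. f i \<rightarrow>\<^bsub>G\<^esub> f j \<longleftrightarrow> (i, j) \<in> E \<union> E\<inverse>)"
  have full: "?full f \<longleftrightarrow> path_or_square_in G cyc (f 1) (f 2) (f 3) (f 4)" for f
  proof -
    have "f 2 \<rightarrow>\<^bsub>G\<^esub> f 1 \<longleftrightarrow> f 1 \<rightarrow>\<^bsub>G\<^esub> f 2" "f 3 \<rightarrow>\<^bsub>G\<^esub> f 1 \<longleftrightarrow> f 1 \<rightarrow>\<^bsub>G\<^esub> f 3" "f 4 \<rightarrow>\<^bsub>G\<^esub> f 1 \<longleftrightarrow> f 1 \<rightarrow>\<^bsub>G\<^esub> f 4"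
      "f 3 \<rightarrow>\<^bsub>G\<^esub> f 2 \<longleftrightarrow> f 2 \<rightarrow>\<^bsub>G\<^esub> f 3" "f 4 \<rightarrow>\<^bsub>G\<^esub> f 2 \<longleftrightarrow> f 2 \<rightarrow>\<^bsub>G\<^esub> f 4" "f 4 \<rightarrow>\<^bsub>G\<^esub> f 3 \<longleftrightarrow> f 3 \<rightarrow>\<^bsub>G\<^esub> f 4"
      by (rule adj_commute)+
    moreover have "\<not> v \<rightarrow>\<^bsub>G\<^esub> v" for v using adj_not_same by blast
    ultimately show ?thesis
      unfolding path_or_square_in_def E by (cases cyc) (simp_all, blast+)
  qed
  have "has_full_subgraph_iso G (undirected_graph ?V E) \<longleftrightarrow> (\<exists>f. ?full f)"
    by (rule full_subgraph_iso_undirected_graph) (auto simp: E)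
  also have "\<dots> \<longleftrightarrow> (\<exists>a b c d. path_or_square_in G cyc a b c d)"
  proof
    assume "\<exists>a b c d. path_or_square_in G cyc a b c d"
    then obtain a b c d where abcd: "path_or_square_in G cyc a b c d" by blast
    define f where "f i = (if i = 1 then a else if i = 2 then b else if i = 3 then c else d)" for i :: nat
    have "?full f" unfolding full using abcd by (simp add: f_def)
    then show "\<exists>f. ?full f" by (rule exI[of ?full])
  next
    assume "\<exists>f. ?full f"
    then show "\<exists>a b c d. path_or_square_in G cyc a b c d" unfolding full by (elim exE) (intro exI)
  qed
  finally show ?thesis .
qed

lemma full_square_iff: "has_full_subgraph_iso G square \<longleftrightarrow> (\<exists>a b c d. path_or_square_in G True a b c d)"
  unfolding square_def by (rule full_path_or_square_iff) auto

lemma full_path_length_3_iff: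
  "has_full_subgraph_iso G path_length_3 \<longleftrightarrow> (\<exists>a b c d. path_or_square_in G False a b c d)"
  unfolding path_length_3_def by (rule full_path_or_square_iff) auto

end

section \<open>Non-separable subgroups\<close>

context group begin

section \<open>A criterion for non-separability\<close>

text \<open>By the pigeonhole principle two powers of \<open>c\<close> lie in the same
  coset.\<close>

lemma pow_mem_finite_index:
  assumes N: "finite_index_normal N G" and c: "c \<in> carrier G"
  obtains n :: nat where "n > 0" "c [^] n \<in> N"
proof -
  have N': "N \<lhd> G" using N by (simp add: finite_index_normal_def)
  then have sub: "subgroup N G" by (rule normal_imp_subgroup)
  have "range (\<lambda>n::nat. N #> c [^] n) \<subseteq> rcosets N" using c by (auto simp: RCOSETS_def)
  then have "finite (range (\<lambda>n::nat. N #> c [^] n))"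
    using N finite_subset by (auto simp: finite_index_normal_def)
  then have "\<not> inj (\<lambda>n::nat. N #> c [^] n)" using finite_imageD by blast
  then obtain i j :: nat where ij: "i < j" "N #> c [^] i = N #> c [^] j"
    unfolding inj_def by (metis linorder_neqE_nat)
  have "c [^] j \<in> N #> c [^] i" unfolding ij(2) using c sub by (intro rcos_self) auto
  then obtain n where n: "n \<in> N" "c [^] j = n \<otimes> c [^] i" by (auto simp: r_coset_def)
  have nG: "n \<in> carrier G" using n subgroup.mem_carrier[OF sub] by blast
  have "c [^] (j - i) \<otimes> c [^] i = n \<otimes> c [^] i" using c ij(1) n by (simp add: nat_pow_mult)
  then have "c [^] (j - i) = n" using c nG by simp
  then show thesis using that[of "j - i"] n ij by simp
qed

text \<open>Applied with \<open>K\<close> the product of the generated subgroup and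
  \<open>N\<close>. Of its finite index only one consequence is kept: every element has a positive
  power in \<open>K\<close>.\<close>

lemma not_subgroup_separableI:
  assumes A: "finite A" "A \<subseteq> carrier G" and x: "x \<in> carrier G" "x \<notin> generate G A"
    and K: "\<And>K. subgroup K G \<Longrightarrow> A \<subseteq> K \<Longrightarrow> (\<And>c. c \<in> carrier G \<Longrightarrow> \<exists>n::nat. n > 0 \<and> c [^] n \<in> K) \<Longrightarrow> x \<in> K"
  shows "\<not> subgroup_separable G"
proof
  let ?H = "generate G A"
  assume "subgroup_separable G"
  moreover have "finitely_generated_subgroup ?H G"
    using A unfolding finitely_generated_subgroup_def by blast
  ultimately have "closedin (profinite_topology G) ?H" by (simp add: subgroup_separable_def)
  moreover have H: "subgroup ?H G" using A generate_is_subgroup by simp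
  ultimately have "?H = (\<Inter>N\<in>{N. finite_index_normal N G}. ?H <#> N)"
    using closedin_profinite_topology by blast
  moreover have "x \<in> ?H <#> N" if N: "finite_index_normal N G" for N
  proof (rule K)
    have N': "N \<lhd> G" using N by (simp add: finite_index_normal_def)
    then have sub: "subgroup N G" by (rule normal_imp_subgroup)
    show "subgroup (?H <#> N) G"
      using mult_norm_subgroup[OF N' H] commut_normal[OF H N'] by simp
    show "A \<subseteq> ?H <#> N"
    proof
      fix a assume a: "a \<in> A"
      then have "a \<otimes> \<one> \<in> ?H <#> N"
        using generate.incl[of a A G] subgroup.one_closed[OF sub] unfolding set_mult_def by blast
      then show "a \<in> ?H <#> N" using a A by auto
    qed
    show "\<exists>n::nat. n > 0 \<and> c [^] n \<in> ?H <#> N" if c: "c \<in> carrier G" for c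
    proof -
      obtain n :: nat where n: "n > 0" "c [^] n \<in> N" using pow_mem_finite_index[OF N c] .
      have "\<one> \<otimes> c [^] n \<in> ?H <#> N"
        using n subgroup.one_closed[OF H] unfolding set_mult_def by blast
      then show ?thesis using n c by auto
    qed
  qed
  ultimately show False using x by blast
qed

lemma l_coset_eq_iff:
  assumes K: "subgroup K G" and g: "g \<in> carrier G" "h \<in> carrier G"
  shows "g <# K = h <# K \<longleftrightarrow> inv h \<otimes> g \<in> K"
proof
  interpret K: subgroup K G by fact
  assume "g <# K = h <# K"
  moreover have "g \<otimes> \<one> \<in> g <# K" unfolding l_coset_def using K.one_closed by blast
  ultimately have "g \<in> h <# K" using g by simp
  then obtain k where "k \<in> K" "g = h \<otimes> k" by (auto simp: l_coset_def)
  then show "inv h \<otimes> g \<in> K" using g by (simp add: m_assoc[symmetric])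
next
  assume k: "inv h \<otimes> g \<in> K"
  then have "(inv h \<otimes> g) <# K = K" using coset_join3 g K by blast
  then have "h <# ((inv h \<otimes> g) <# K) = h <# K" by simp
  then show "g <# K = h <# K"
    using g subgroup.subset[OF K] by (simp add: lcos_m_assoc m_assoc[symmetric])
qed

lemma l_coset_cong:
  assumes "subgroup K G" "g \<in> carrier G" "h \<in> carrier G" "k \<in> carrier G" "g <# K = h <# K"
  shows "(k \<otimes> g) <# K = (k \<otimes> h) <# K"
  using assms lcos_m_assoc subgroup.subset by metis

lemma least_power:
  assumes "\<exists>n::nat. n > 0 \<and> c [^] n \<in> K"
  obtains n :: nat where "n > 0" "c [^] n \<in> K" "\<And>j. 0 < j \<Longrightarrow> j < n \<Longrightarrow> c [^] j \<notin> K"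
  using assms exists_least_iff[of "\<lambda>n::nat. n > 0 \<and> c [^] n \<in> K"] by blast

section \<open>Words in every finite index overgroup\<close>

text \<open>
  Writing \<open>q g\<close> for the coset \<open>gK\<close>, the generators force \<open>q (dac\<^bsup>2k\<^esup>) = q (c\<^bsup>k\<^esup>)\<close>. Hence the \<open>c\<close>-orbit of
  \<open>K\<close>, being finite, has odd length, so that \<open>c\<close> acts on it as an even power of itself.
\<close>

lemma path_word_mem:
  assumes K: "subgroup K G" and carr: "a \<in> carrier G" "b \<in> carrier G" "c \<in> carrier G" "d \<in> carrier G"
    and ab: "a \<otimes> b = b \<otimes> a" and bc: "b \<otimes> c = c \<otimes> b" and cd: "c \<otimes> d = d \<otimes> c"
    and pow: "\<exists>n::nat. n > 0 \<and> c [^] n \<in> K"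
    and gens: "inv (c \<otimes> c) \<otimes> b \<in> K" "inv (c \<otimes> a) \<otimes> (b \<otimes> a) \<in> K" "d \<otimes> a \<in> K"
  shows "inv (c \<otimes> c \<otimes> (d \<otimes> (a \<otimes> c))) \<otimes> (b \<otimes> (d \<otimes> (a \<otimes> c))) \<in> K"
proof -
  define q where "q g = g <# K" for g
  have iff: "q g = q h \<longleftrightarrow> inv h \<otimes> g \<in> K" if "g \<in> carrier G" "h \<in> carrier G" for g h
    unfolding q_def using K that by (rule l_coset_eq_iff)
  have iff1: "q g = q \<one> \<longleftrightarrow> g \<in> K" if "g \<in> carrier G" for g using iff[OF that one_closed] that by simp
  have cong: "q (k \<otimes> g) = q (k \<otimes> h)"
    if "q g = q h" "k \<in> carrier G" "g \<in> carrier G" "h \<in> carrier G" for g h k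
    using l_coset_cong[OF K that(3,4,2)] that(1) by (simp add: q_def)
  have gens': "q b = q (c \<otimes> c)" "q (b \<otimes> a) = q (c \<otimes> a)" "q (d \<otimes> a) = q \<one>"
    using gens carr by (simp_all add: iff iff1)
  have bck: "b \<otimes> c [^] k = c [^] k \<otimes> b" for k :: nat
    using group_commutes_pow[OF bc[symmetric]] carr by simp
  have dck: "d \<otimes> c [^] k = c [^] k \<otimes> d" for k :: nat
    using group_commutes_pow[OF cd] carr by simp
  have 1: "q (b \<otimes> c [^] k) = q (c [^] (k + 2))" for k :: nat
    unfolding bck using cong[OF gens'(1), of "c [^] k"] carr by (simp add: m_assoc)
  have 2: "q (b \<otimes> (c [^] k \<otimes> a)) = q (c [^] Suc k \<otimes> a)" for k :: nat
  proof -
    have "b \<otimes> (c [^] k \<otimes> a) = c [^] k \<otimes> (b \<otimes> a)" using bck carr by (metis m_assoc nat_pow_closed)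
    then show ?thesis using cong[OF gens'(2), of "c [^] k"] carr by (simp add: m_assoc)
  qed
  \<comment> \<open>Next to \<open>K\<close>, a factor \<open>c\<^sup>2\<close> can be traded for
    \<open>b\<close>, which passes through \<open>a\<close> and comes out as a single
    \<open>c\<close>.\<close>
  have 3: "q (a \<otimes> c [^] (2 * k)) = q (c [^] k \<otimes> a)" for k :: nat
  proof (induction k)
    case (Suc k)
    have "q (a \<otimes> c [^] (2 * Suc k)) = q (a \<otimes> (b \<otimes> c [^] (2 * k)))"
      using 1[of "2 * k"] carr by (intro cong) simp_all
    also have "a \<otimes> (b \<otimes> c [^] (2 * k)) = b \<otimes> (a \<otimes> c [^] (2 * k))"
      using ab carr by (metis m_assoc nat_pow_closed)
    also have "q \<dots> = q (b \<otimes> (c [^] k \<otimes> a))" using carr Suc by (intro cong) simp_all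
    also have "\<dots> = q (c [^] Suc k \<otimes> a)" by (rule 2)
    finally show ?case .
  qed (use carr in simp)
  have 4: "q (d \<otimes> (c [^] k \<otimes> a)) = q (c [^] k)" for k :: nat
  proof -
    have "d \<otimes> (c [^] k \<otimes> a) = c [^] k \<otimes> (d \<otimes> a)" using dck carr by (metis m_assoc nat_pow_closed)
    then show ?thesis using cong[OF gens'(3), of "c [^] k"] carr by simp
  qed
  have 5: "q (d \<otimes> (a \<otimes> c [^] (2 * k))) = q (c [^] k)" for k :: nat
    using cong[OF 3[of k], of d] 4[of k] carr by simp
  obtain n :: nat where n: "n > 0" "c [^] n \<in> K" "\<And>j. 0 < j \<Longrightarrow> j < n \<Longrightarrow> c [^] j \<notin> K"
    using least_power[OF pow] by metis
  have qn: "q (c [^] n) = q \<one>" using n carr iff1 by simp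
  \<comment> \<open>If \<open>n = 2 * j\<close>, then fact 5 shows that \<open>c [^] j\<close> also
    fixes the coset \<open>K\<close>, against minimality.\<close>
  have "odd n"
  proof
    assume "even n"
    then obtain j where j: "n = 2 * j" by blast
    have "q (a \<otimes> c [^] n) = q (a \<otimes> \<one>)" using qn carr by (intro cong) simp_all
    then have "q (d \<otimes> (a \<otimes> c [^] n)) = q (d \<otimes> a)" using carr cong[of "a \<otimes> c [^] n" a d] by simp
    then have "q (c [^] j) = q \<one>" using 5[of j] gens'(3) j by simp
    then have "c [^] j \<in> K" using carr iff1 by simp
    then show False using n(1) n(3)[of j] j by simp
  qed
  \<comment> \<open>Since \<open>c [^] n\<close> fixes \<open>K\<close>, the element
    \<open>c\<close> acts on \<open>K\<close> as \<open>c [^] (2 * k)\<close>. Fact 5 then puts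
    \<open>dac\<close> into the coset of \<open>c [^] k\<close>, on which \<open>b\<close> acts as
    \<open>c\<^sup>2\<close>.\<close>
  then obtain k where k: "2 * k = Suc n" by (metis even_Suc dvdE)
  have "q (c [^] (2 * k)) = q (c \<otimes> \<one>)"
    unfolding k nat_pow_Suc2[OF carr(3)] using qn carr by (intro cong) simp_all
  then have "q (a \<otimes> c) = q (a \<otimes> c [^] (2 * k))" using carr by (intro cong) simp_all
  then have "q (d \<otimes> (a \<otimes> c)) = q (c [^] k)"
    using carr cong[of "a \<otimes> c" "a \<otimes> c [^] (2 * k)" d] 5[of k] by simp
  then have "q (b \<otimes> (d \<otimes> (a \<otimes> c))) = q (b \<otimes> c [^] k)"
    and "q (c \<otimes> c \<otimes> (d \<otimes> (a \<otimes> c))) = q (c \<otimes> c \<otimes> c [^] k)"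
    using carr by ((intro cong; simp)+)
  moreover have "c \<otimes> c \<otimes> c [^] k = c [^] Suc (Suc k)"
    using carr by (simp only: nat_pow_Suc2 m_assoc nat_pow_closed)
  ultimately have "q (b \<otimes> (d \<otimes> (a \<otimes> c))) = q (c \<otimes> c \<otimes> (d \<otimes> (a \<otimes> c)))" using 1[of k] by (simp del: nat_pow_Suc)
  then show ?thesis using iff carr by simp
qed

text \<open>
  On cosets of \<open>K\<close>, right multiplication by \<open>a\<close> and \<open>b\<close> inside the centralizer \<open>Z\<close> amounts to left
  multiplication by \<open>c\<close> and \<open>d\<close>. Thus \<open>K \<inter> Z\<close> behaves like a normal subgroup with quotient
  satisfying \<open>a\<^sup>2b = ba\<^sup>3\<close>; as \<open>a\<close> has finite order there, this order is odd and
  \<open>b\<^sup>-\<^sup>1ab\<close> is a power of \<open>a\<close>.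
\<close>

lemma square_word_mem:
  assumes K: "subgroup K G" and carr: "a \<in> carrier G" "b \<in> carrier G" "c \<in> carrier G" "d \<in> carrier G"
    and comm: "c \<otimes> a = a \<otimes> c" "c \<otimes> b = b \<otimes> c" "d \<otimes> a = a \<otimes> d" "d \<otimes> b = b \<otimes> d"
    and pow: "\<exists>n::nat. n > 0 \<and> a [^] n \<in> K"
    and gens: "inv c \<otimes> a \<in> K" "inv d \<otimes> b \<in> K" "inv (b \<otimes> (a \<otimes> a \<otimes> a)) \<otimes> (a \<otimes> a \<otimes> b) \<in> K"
  shows "inv (inv b \<otimes> (a \<otimes> b) \<otimes> a) \<otimes> (a \<otimes> (inv b \<otimes> (a \<otimes> b))) \<in> K"
proof -
  define q where "q g = g <# K" for g
  have iff: "q g = q h \<longleftrightarrow> inv h \<otimes> g \<in> K" if "g \<in> carrier G" "h \<in> carrier G" for g h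
    unfolding q_def using K that by (rule l_coset_eq_iff)
  have iff1: "q g = q \<one> \<longleftrightarrow> g \<in> K" if "g \<in> carrier G" for g using iff[OF that one_closed] that by simp
  have cong: "q (k \<otimes> g) = q (k \<otimes> h)"
    if "q g = q h" "k \<in> carrier G" "g \<in> carrier G" "h \<in> carrier G" for g h k
    using l_coset_cong[OF K that(3,4,2)] that(1) by (simp add: q_def)
  have gens': "q a = q c" "q b = q d" "q (a \<otimes> a \<otimes> b) = q (b \<otimes> (a \<otimes> a \<otimes> a))"
    using gens carr by (simp_all add: iff)
  define Z where "Z = {g \<in> carrier G. c \<otimes> g = g \<otimes> c \<and> d \<otimes> g = g \<otimes> d}"
  have ZG: "g \<in> carrier G" if "g \<in> Z" for g using that by (simp add: Z_def)
  have ab: "a \<in> Z" "b \<in> Z" using carr comm by (simp_all add: Z_def)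
  have Zmult: "g \<otimes> h \<in> Z" if "g \<in> Z" "h \<in> Z" for g h
  proof -
    have "x \<otimes> (g \<otimes> h) = g \<otimes> h \<otimes> x"
      if "x \<in> carrier G" "x \<otimes> g = g \<otimes> x" "x \<otimes> h = h \<otimes> x" for x
      using that ZG[OF \<open>g \<in> Z\<close>] ZG[OF \<open>h \<in> Z\<close>] by (metis m_assoc)
    then show ?thesis using that carr by (simp add: Z_def)
  qed
  have Zinv: "inv g \<in> Z" if "g \<in> Z" for g
  proof -
    have "x \<otimes> inv g = inv g \<otimes> x" if "x \<in> carrier G" "x \<otimes> g = g \<otimes> x" for x
      using that ZG[OF \<open>g \<in> Z\<close>] by (metis inv_closed inv_solve_left inv_solve_right m_assoc m_closed)
    then show ?thesis using that carr by (simp add: Z_def)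
  qed
  have Zpow: "a [^] m \<in> Z" for m :: nat
  proof (induction m)
    case 0
    then show ?case using carr by (simp add: Z_def)
  qed (simp add: Zmult ab)
  \<comment> \<open>The factor \<open>a\<close> next to \<open>K\<close> is replaced by
    \<open>c\<close>, which then passes through \<open>g\<close>.\<close>
  have La: "q (g \<otimes> a) = q (c \<otimes> g)" if "g \<in> Z" for g
    using cong[OF gens'(1), of g] that carr by (simp add: Z_def)
  have Lb: "q (g \<otimes> b) = q (d \<otimes> g)" if "g \<in> Z" for g
    using cong[OF gens'(2), of g] that carr by (simp add: Z_def)
  have Lpow: "q (g \<otimes> a [^] m) = q (c [^] m \<otimes> g)" if g: "g \<in> Z" for g and m :: nat
  proof (induction m)
    case 0
    then show ?case using ZG[OF g] by simp
  next
    case (Suc m)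
    have "q (g \<otimes> a [^] Suc m) = q (c \<otimes> (g \<otimes> a [^] m))"
      using La[OF Zmult[OF g Zpow[of m]]] ZG[OF g] carr by (simp add: m_assoc)
    also have "\<dots> = q (c \<otimes> (c [^] m \<otimes> g))" using ZG[OF g] carr Suc by (intro cong) simp_all
    also have "c \<otimes> (c [^] m \<otimes> g) = c [^] Suc m \<otimes> g"
      using ZG[OF g] carr by (simp only: nat_pow_Suc2 m_assoc nat_pow_closed m_closed mult_Suc_right add_2_eq_Suc)
    finally show ?case .
  qed
  \<comment> \<open>The relation is available only next to \<open>K\<close>, so the trailing
    \<open>a [^] (3 * k)\<close> is moved to the front as a power of \<open>c\<close>, the relation
    applied, and the power moved back.\<close>
  have 2: "q (a [^] (2 * k) \<otimes> b) = q (b \<otimes> a [^] (3 * k))" for k :: nat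
  proof (induction k)
    case 0
    then show ?case using carr by simp
  next
    case (Suc k)
    have "a [^] (2 * Suc k) \<otimes> b = a \<otimes> a \<otimes> (a [^] (2 * k) \<otimes> b)"
      using carr by (simp only: nat_pow_Suc2 m_assoc nat_pow_closed m_closed mult_Suc_right add_2_eq_Suc)
    also have "q \<dots> = q (a \<otimes> a \<otimes> (b \<otimes> a [^] (3 * k)))" using carr Suc by (intro cong) simp_all
    also have "a \<otimes> a \<otimes> (b \<otimes> a [^] (3 * k)) = a \<otimes> a \<otimes> b \<otimes> a [^] (3 * k)" using carr by (simp add: m_assoc)
    also have "q \<dots> = q (c [^] (3 * k) \<otimes> (a \<otimes> a \<otimes> b))" by (rule Lpow) (intro Zmult ab)
    also have "\<dots> = q (c [^] (3 * k) \<otimes> (b \<otimes> (a \<otimes> a \<otimes> a)))" using carr gens'(3) by (intro cong) simp_all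
    also have "\<dots> = q (b \<otimes> (a \<otimes> a \<otimes> a) \<otimes> a [^] (3 * k))" by (rule Lpow[symmetric]) (intro Zmult ab)
    also have "b \<otimes> (a \<otimes> a \<otimes> a) \<otimes> a [^] (3 * k) = b \<otimes> a [^] (3 * Suc k)"
      using carr by (simp only: nat_pow_Suc2 m_assoc nat_pow_closed m_closed mult_Suc_right add_Suc numeral_3_eq_3 add_0)
    finally show ?case .
  qed
  obtain n :: nat where n: "n > 0" "a [^] n \<in> K" "\<And>j. 0 < j \<Longrightarrow> j < n \<Longrightarrow> a [^] j \<notin> K"
    using least_power[OF pow] by metis
  have qn: "q (a [^] n) = q \<one>" using n carr iff1 by simp
  \<comment> \<open>For \<open>n = 2 * j\<close>, fact 2 gives \<open>a [^] (3 * j)\<close> in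
    \<open>K\<close>; removing \<open>a [^] n\<close> leaves \<open>a [^] j\<close>, against
    minimality.\<close>
  have "odd n"
  proof
    assume "even n"
    then obtain j where j: "n = 2 * j" by blast
    have "q (b \<otimes> a [^] (3 * j)) = q (d \<otimes> a [^] n)" using 2[of j] Lb[OF Zpow[of n]] j by simp
    also have "\<dots> = q (d \<otimes> \<one>)" using qn carr by (intro cong) simp_all
    also have "\<dots> = q b" using gens'(2) carr by simp
    finally have "q (inv b \<otimes> (b \<otimes> a [^] (3 * j))) = q (inv b \<otimes> b)" using carr by (intro cong) simp_all
    then have "q (a [^] (3 * j)) = q \<one>" using carr by (simp add: m_assoc[symmetric])
    moreover have "a [^] (3 * j) = a [^] j \<otimes> a [^] n" using carr by (simp add: nat_pow_mult j)
    moreover have "q (a [^] j \<otimes> a [^] n) = q (a [^] j \<otimes> \<one>)" using qn carr by (intro cong) simp_all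
    ultimately have "a [^] j \<in> K" using carr iff1 by simp
    then show False using n(1) n(3)[of j] j by simp
  qed
  \<comment> \<open>Modulo \<open>K\<close>, now \<open>a\<close> is \<open>a [^] (2 * k)\<close>,
    which conjugation by \<open>b\<close> turns into \<open>a [^] (3 * k)\<close>.\<close>
  then obtain k where k: "2 * k = Suc n" by (metis even_Suc dvdE)
  have "q (a [^] (2 * k)) = q (a \<otimes> \<one>)"
    unfolding k nat_pow_Suc2[OF carr(1)] using qn carr by (intro cong) simp_all
  then have "q (d \<otimes> a) = q (d \<otimes> a [^] (2 * k))" using carr by (intro cong) simp_all
  then have "q (a \<otimes> b) = q (b \<otimes> a [^] (3 * k))"
    using Lb[OF ab(1)] Lb[OF Zpow[of "2 * k"]] 2[of k] by simp
  then have "q (inv b \<otimes> (a \<otimes> b)) = q (inv b \<otimes> (b \<otimes> a [^] (3 * k)))" using carr by (intro cong) simp_all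
  then have t: "q (inv b \<otimes> (a \<otimes> b)) = q (a [^] (3 * k))" using carr by (simp add: m_assoc[symmetric])
  have "q (inv b \<otimes> (a \<otimes> b) \<otimes> a) = q (c \<otimes> (inv b \<otimes> (a \<otimes> b)))" by (intro La Zmult Zinv ab)
  also have "\<dots> = q (c \<otimes> a [^] (3 * k))" using t carr by (intro cong) simp_all
  also have "\<dots> = q (a [^] (3 * k) \<otimes> a)" by (rule La[OF Zpow, symmetric])
  also have "a [^] (3 * k) \<otimes> a = a \<otimes> a [^] (3 * k)" using carr by (metis nat_pow_Suc nat_pow_Suc2)
  also have "q \<dots> = q (a \<otimes> (inv b \<otimes> (a \<otimes> b)))" using t carr by (intro cong) simp_all
  finally have "q (a \<otimes> (inv b \<otimes> (a \<otimes> b))) = q (inv b \<otimes> (a \<otimes> b) \<otimes> a)" by (rule HOL.sym)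
  then show ?thesis using iff carr by simp
qed

end

section \<open>Infinite permutation representations\<close>

text \<open>
  The action on the Schreier graph that distinguishes the word of \<open>path_word_mem\<close> from the subgroup:
  the base point is \<open>(0, 0)\<close>, \<open>c\<close> has infinite orbits \<open>\<int> \<times> {i}\<close>, and \<open>b\<close> acts as \<open>c\<^sup>2\<close> on the orbit
  \<open>i = 0\<close> and as \<open>c\<close> on the others. Since \<open>a\<close> has to commute with \<open>b\<close>, it permutes the \<open>b\<close>-orbits, of
  which \<open>i = 0\<close> contributes two.
\<close>

definition path_a :: "int \<times> int \<Rightarrow> int \<times> int" where
  "path_a = (\<lambda>(n, i). if i = 0 then (n div 2, if even n then 1 else 2)
    else if i = -1 then (2 * n, 0) else if i = -2 then (2 * n + 1, 0) else (n, i + 2))"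

definition path_b :: "int \<times> int \<Rightarrow> int \<times> int" where
  "path_b = (\<lambda>(n, i). (if i = 0 then n + 2 else n + 1, i))"

definition path_c :: "int \<times> int \<Rightarrow> int \<times> int" where
  "path_c = (\<lambda>(n, i). (n + 1, i))"

definition path_d :: "int \<times> int \<Rightarrow> int \<times> int" where
  "path_d = (\<lambda>(n, i). (n, i - 1))"

lemma permutes_UNIV_if_inverse:
  assumes "\<And>x. g (f x) = x" "\<And>x. f (g x) = x"
  shows "f permutes UNIV"
proof -
  have "bij f" by (rule o_bij[of g]) (simp_all add: assms fun_eq_iff)
  then show ?thesis by (rule bij_imp_permutes) simp
qed

lemma path_perms: "path_a permutes UNIV" "path_b permutes UNIV" "path_c permutes UNIV" "path_d permutes UNIV"
proof -
  let ?a = "\<lambda>(n, i). if i = 0 then (n div 2, if even n then -1 else -2)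
    else if i = 1 then (2 * n, 0) else if i = 2 then (2 * n + 1, 0) else (n :: int, i - 2 :: int)"
  show "path_a permutes UNIV"
    by (rule permutes_UNIV_if_inverse[of ?a]) (auto simp: path_a_def split: if_splits)
  show "path_b permutes UNIV"
    by (rule permutes_UNIV_if_inverse[of "\<lambda>(n, i). (if i = 0 then n - 2 else n - 1, i)"]) (auto simp: path_b_def)
  show "path_c permutes UNIV"
    by (rule permutes_UNIV_if_inverse[of "\<lambda>(n, i). (n - 1, i)"]) (auto simp: path_c_def)
  show "path_d permutes UNIV"
    by (rule permutes_UNIV_if_inverse[of "\<lambda>(n, i). (n, i + 1)"]) (auto simp: path_d_def)
qed

lemma path_perms_commute:
  "path_a (path_b x) = path_b (path_a x)" "path_b (path_c x) = path_c (path_b x)"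
  "path_c (path_d x) = path_d (path_c x)"
  by (cases x; auto simp: path_a_def path_b_def path_c_def path_d_def)+

text \<open>
  An action of the Baumslag--Solitar group with relation \<open>a\<^sup>2b = ba\<^sup>3\<close>: both
  \<open>a\<^sup>2\<close> and \<open>a\<^sup>3\<close> have infinitely many infinite orbits, and \<open>b\<close> matches them up.
\<close>

definition bs_a :: "int \<times> int \<Rightarrow> int \<times> int" where
  "bs_a = (\<lambda>(n, i). (n + 1, i))"

text \<open>The integer \<open>3 * i + n mod 3\<close> numbers the orbits of
  \<open>a\<^sup>3\<close>, and \<open>n div 3\<close> is the position within one. The image is the
  point with the same position in the orbit of \<open>a\<^sup>2\<close> with the same
  number.\<close>

definition bs_b :: "int \<times> int \<Rightarrow> int \<times> int" where
  "bs_b = (\<lambda>(n, i). (2 * (n div 3) + (3 * i + n mod 3) mod 2, (3 * i + n mod 3) div 2))"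

definition bs_b_inv :: "int \<times> int \<Rightarrow> int \<times> int" where
  "bs_b_inv = (\<lambda>(n, i). (3 * (n div 2) + (2 * i + n mod 2) mod 3, (2 * i + n mod 2) div 3))"

lemma bs_b_inverse: "bs_b_inv (bs_b x) = x" "bs_b (bs_b_inv x) = x"
proof -
  obtain n i where x: "x = (n, i)" by (cases x)
  show "bs_b_inv (bs_b x) = x" unfolding x bs_b_def bs_b_inv_def by simp
  show "bs_b (bs_b_inv x) = x" unfolding x bs_b_def bs_b_inv_def by simp
qed

lemma bs_perms: "bs_a permutes UNIV" "bs_b permutes UNIV"
  by (rule permutes_UNIV_if_inverse[of "\<lambda>(n, i). (n - 1, i)"], auto simp: bs_a_def)[1]
    (rule permutes_UNIV_if_inverse[OF bs_b_inverse])

lemma bs_relation: "bs_a (bs_a (bs_b x)) = bs_b (bs_a (bs_a (bs_a x)))"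
  by (cases x) (simp add: bs_a_def bs_b_def)

context graph begin

text \<open>Vertices off the path act trivially, and fullness of the path ensures that no further
  commutation is demanded. The subgroup fixes \<open>(0, 0)\<close>, but the word does not.\<close>

lemma not_separable_if_path:
  assumes "path_or_square_in G False a b c d"
  shows "\<not> subgroup_separable (raag G)"
proof -
  let ?A = "raag G" and ?g = "raag_gen G" and ?K = "perm_group (UNIV :: (int \<times> int) set)"
  interpret A: group ?A by (rule group_raag)
  interpret K: group ?K by (rule group_perm_group)
  have V: "a \<in> verts G" "b \<in> verts G" "c \<in> verts G" "d \<in> verts G" and dist: "distinct [a, b, c, d]"
    and adj: "a \<rightarrow>\<^bsub>G\<^esub> b" "b \<rightarrow>\<^bsub>G\<^esub> c" "c \<rightarrow>\<^bsub>G\<^esub> d" and nonadj: "\<not> a \<rightarrow>\<^bsub>G\<^esub> c" "\<not> b \<rightarrow>\<^bsub>G\<^esub> d" "\<not> a \<rightarrow>\<^bsub>G\<^esub> d"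
    using assms by (simp_all add: path_or_square_in_def)
  have nonadj': "\<not> c \<rightarrow>\<^bsub>G\<^esub> a" "\<not> d \<rightarrow>\<^bsub>G\<^esub> b" "\<not> d \<rightarrow>\<^bsub>G\<^esub> a" using nonadj adj_commute by blast+
  define f where "f v = (if v = a then path_a else if v = b then path_b else if v = c then path_c
    else if v = d then path_d else id)" for v
  have "f \<in> verts G \<rightarrow> carrier ?K" using path_perms by (auto simp: f_def permutes_id)
  moreover have "f u \<otimes>\<^bsub>?K\<^esub> f v = f v \<otimes>\<^bsub>?K\<^esub> f u" if uv: "u \<rightarrow>\<^bsub>G\<^esub> v" for u v
    using uv nonadj nonadj' path_perms_commute unfolding f_def by (auto simp: fun_eq_iff)
  ultimately obtain \<phi> where \<phi>: "\<phi> \<in> hom ?A ?K" and \<phi>f: "\<And>v. v \<in> verts G \<Longrightarrow> \<phi> (?g v) = f v"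
    using raag_hom[OF group_perm_group] by metis
  interpret group_hom ?A ?K \<phi> by unfold_locales (rule \<phi>)
  define ga gb gc gd where "ga = ?g a" and "gb = ?g b" and "gc = ?g c" and "gd = ?g d"
  note gdefs = ga_def gb_def gc_def gd_def
  have carr: "ga \<in> carrier ?A" "gb \<in> carrier ?A" "gc \<in> carrier ?A" "gd \<in> carrier ?A"
    using V by (simp_all add: gdefs raag_gen_closed)
  have img: "\<phi> ga = path_a" "\<phi> gb = path_b" "\<phi> gc = path_c" "\<phi> gd = path_d"
    using V dist by (auto simp: \<phi>f f_def gdefs)
  note mem_iff = hom_inv_mult_fixes_iff[OF A.group_axioms \<phi>, where p = "(0, 0)"]
  let ?S = "{inv\<^bsub>?A\<^esub> (gc \<otimes>\<^bsub>?A\<^esub> gc) \<otimes>\<^bsub>?A\<^esub> gb, inv\<^bsub>?A\<^esub> (gc \<otimes>\<^bsub>?A\<^esub> ga) \<otimes>\<^bsub>?A\<^esub> (gb \<otimes>\<^bsub>?A\<^esub> ga), gd \<otimes>\<^bsub>?A\<^esub> ga}"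
  let ?x = "inv\<^bsub>?A\<^esub> (gc \<otimes>\<^bsub>?A\<^esub> gc \<otimes>\<^bsub>?A\<^esub> (gd \<otimes>\<^bsub>?A\<^esub> (ga \<otimes>\<^bsub>?A\<^esub> gc))) \<otimes>\<^bsub>?A\<^esub> (gb \<otimes>\<^bsub>?A\<^esub> (gd \<otimes>\<^bsub>?A\<^esub> (ga \<otimes>\<^bsub>?A\<^esub> gc)))"
  show ?thesis
  proof (rule A.not_subgroup_separableI)
    show S: "finite ?S" "?S \<subseteq> carrier ?A" "?x \<in> carrier ?A" using carr by auto
    note defs = path_a_def path_b_def path_c_def path_d_def
    have "\<phi> (inv\<^bsub>?A\<^esub> (gc \<otimes>\<^bsub>?A\<^esub> gc) \<otimes>\<^bsub>?A\<^esub> gb) (0, 0) = (0, 0)"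
      "\<phi> (inv\<^bsub>?A\<^esub> (gc \<otimes>\<^bsub>?A\<^esub> ga) \<otimes>\<^bsub>?A\<^esub> (gb \<otimes>\<^bsub>?A\<^esub> ga)) (0, 0) = (0, 0)"
      by (subst mem_iff; use carr in \<open>simp add: img defs\<close>)+
    moreover have "\<phi> (gd \<otimes>\<^bsub>?A\<^esub> ga) (0, 0) = (0, 0)" using carr by (simp add: img defs)
    ultimately have "?S \<subseteq> {y \<in> carrier ?A. \<phi> y (0, 0) = (0, 0)}" using S(2) by blast
    then have "generate ?A ?S \<subseteq> {y \<in> carrier ?A. \<phi> y (0, 0) = (0, 0)}"
      by (rule A.generate_subgroup_incl) (rule stabilizer_subgroup[OF A.group_axioms \<phi>])
    \<comment> \<open>The element \<open>dac\<close> takes the base point to \<open>(0, 1)\<close>,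
      where \<open>b\<close> moves by one and \<open>c\<^sup>2\<close> by two.\<close>
    moreover have "\<phi> ?x (0, 0) \<noteq> (0, 0)"
      by (subst mem_iff; use carr in \<open>simp add: img defs\<close>)
    ultimately show "?x \<notin> generate ?A ?S" by blast
    fix K assume K: "subgroup K ?A" "?S \<subseteq> K" and pow: "\<And>c. c \<in> carrier ?A \<Longrightarrow> \<exists>n::nat. n > 0 \<and> c [^]\<^bsub>?A\<^esub> n \<in> K"
    show "?x \<in> K"
      by (rule A.path_word_mem[OF K(1) carr _ _ _ pow[OF carr(3)]])
        (use K(2) adj raag_gen_commute in \<open>simp_all add: gdefs\<close>)
  qed
qed

text \<open>The cyclic order is \<open>a\<close>, \<open>c\<close>, \<open>b\<close>,
  \<open>d\<close>, so the nonadjacent pairs \<open>a\<close>, \<open>b\<close> and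
  \<open>c\<close>, \<open>d\<close> belong to the two free factors. The subgroup lies in the
  equalizer of two representations, one for each pair.\<close>

lemma not_separable_if_square:
  assumes "path_or_square_in G True a c b d"
  shows "\<not> subgroup_separable (raag G)"
proof -
  let ?A = "raag G" and ?g = "raag_gen G" and ?K = "perm_group (UNIV :: (int \<times> int) set)"
  interpret A: group ?A by (rule group_raag)
  interpret K: group ?K by (rule group_perm_group)
  have V: "a \<in> verts G" "b \<in> verts G" "c \<in> verts G" "d \<in> verts G" and dist: "distinct [a, c, b, d]"
    and adj: "a \<rightarrow>\<^bsub>G\<^esub> c" "c \<rightarrow>\<^bsub>G\<^esub> b" "b \<rightarrow>\<^bsub>G\<^esub> d" "a \<rightarrow>\<^bsub>G\<^esub> d" and nonadj: "\<not> a \<rightarrow>\<^bsub>G\<^esub> b" "\<not> c \<rightarrow>\<^bsub>G\<^esub> d"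
    using assms by (simp_all add: path_or_square_in_def)
  have adj': "c \<rightarrow>\<^bsub>G\<^esub> a" "d \<rightarrow>\<^bsub>G\<^esub> b" "d \<rightarrow>\<^bsub>G\<^esub> a" and nonadj': "\<not> b \<rightarrow>\<^bsub>G\<^esub> a" "\<not> d \<rightarrow>\<^bsub>G\<^esub> c"
    using adj nonadj adj_commute by blast+
  define f\<^sub>1 where "f\<^sub>1 v = (if v = a then bs_a else if v = b then bs_b else id)" for v
  \<comment> \<open>Inverses, because the subgroup generators are \<open>c\<^sup>-\<^sup>1a\<close>
    and \<open>d\<^sup>-\<^sup>1b\<close>: both representations send these to \<open>bs_a\<close>
    and \<open>bs_b\<close>.\<close>
  define f\<^sub>2 where "f\<^sub>2 v = (if v = c then inv\<^bsub>?K\<^esub> bs_a else if v = d then inv\<^bsub>?K\<^esub> bs_b else id)" for v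
  have PQ: "bs_a \<in> carrier ?K" "bs_b \<in> carrier ?K" using bs_perms by simp_all
  have "f\<^sub>1 \<in> verts G \<rightarrow> carrier ?K" using bs_perms by (auto simp: f\<^sub>1_def permutes_id)
  moreover have "f\<^sub>1 u \<otimes>\<^bsub>?K\<^esub> f\<^sub>1 v = f\<^sub>1 v \<otimes>\<^bsub>?K\<^esub> f\<^sub>1 u" if "u \<rightarrow>\<^bsub>G\<^esub> v" for u v
    using that nonadj nonadj' unfolding f\<^sub>1_def by auto
  ultimately obtain \<phi> where \<phi>: "\<phi> \<in> hom ?A ?K" and \<phi>f: "\<And>v. v \<in> verts G \<Longrightarrow> \<phi> (?g v) = f\<^sub>1 v"
    using raag_hom[OF group_perm_group] by metis
  have "f\<^sub>2 \<in> verts G \<rightarrow> carrier ?K" using K.inv_closed[OF PQ(1)] K.inv_closed[OF PQ(2)]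
    by (auto simp: f\<^sub>2_def permutes_id)
  moreover have "f\<^sub>2 u \<otimes>\<^bsub>?K\<^esub> f\<^sub>2 v = f\<^sub>2 v \<otimes>\<^bsub>?K\<^esub> f\<^sub>2 u" if "u \<rightarrow>\<^bsub>G\<^esub> v" for u v
    using that nonadj nonadj' unfolding f\<^sub>2_def by auto
  ultimately obtain \<psi> where \<psi>: "\<psi> \<in> hom ?A ?K" and \<psi>f: "\<And>v. v \<in> verts G \<Longrightarrow> \<psi> (?g v) = f\<^sub>2 v"
    using raag_hom[OF group_perm_group] by metis
  interpret \<phi>: group_hom ?A ?K \<phi> by unfold_locales (rule \<phi>)
  interpret \<psi>: group_hom ?A ?K \<psi> by unfold_locales (rule \<psi>)
  define ga gb gc gd where "ga = ?g a" and "gb = ?g b" and "gc = ?g c" and "gd = ?g d"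
  note gdefs = ga_def gb_def gc_def gd_def
  have carr: "ga \<in> carrier ?A" "gb \<in> carrier ?A" "gc \<in> carrier ?A" "gd \<in> carrier ?A"
    using V by (simp_all add: gdefs raag_gen_closed)
  have img: "\<phi> ga = bs_a" "\<phi> gb = bs_b" "\<phi> gc = \<one>\<^bsub>?K\<^esub>" "\<phi> gd = \<one>\<^bsub>?K\<^esub>"
    "\<psi> ga = \<one>\<^bsub>?K\<^esub>" "\<psi> gb = \<one>\<^bsub>?K\<^esub>" "\<psi> gc = inv\<^bsub>?K\<^esub> bs_a" "\<psi> gd = inv\<^bsub>?K\<^esub> bs_b"
    using V dist by (auto simp: \<phi>f f\<^sub>1_def \<psi>f f\<^sub>2_def gdefs)
  have rel: "bs_a \<otimes>\<^bsub>?K\<^esub> bs_a \<otimes>\<^bsub>?K\<^esub> bs_b = bs_b \<otimes>\<^bsub>?K\<^esub> (bs_a \<otimes>\<^bsub>?K\<^esub> bs_a \<otimes>\<^bsub>?K\<^esub> bs_a)"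
    by (simp add: fun_eq_iff bs_relation)
  let ?r = "inv\<^bsub>?A\<^esub> (gb \<otimes>\<^bsub>?A\<^esub> (ga \<otimes>\<^bsub>?A\<^esub> ga \<otimes>\<^bsub>?A\<^esub> ga)) \<otimes>\<^bsub>?A\<^esub> (ga \<otimes>\<^bsub>?A\<^esub> ga \<otimes>\<^bsub>?A\<^esub> gb)"
  let ?S = "{inv\<^bsub>?A\<^esub> gc \<otimes>\<^bsub>?A\<^esub> ga, inv\<^bsub>?A\<^esub> gd \<otimes>\<^bsub>?A\<^esub> gb, ?r}"
  let ?u = "inv\<^bsub>?A\<^esub> gb \<otimes>\<^bsub>?A\<^esub> (ga \<otimes>\<^bsub>?A\<^esub> gb)"
  let ?x = "inv\<^bsub>?A\<^esub> (?u \<otimes>\<^bsub>?A\<^esub> ga) \<otimes>\<^bsub>?A\<^esub> (ga \<otimes>\<^bsub>?A\<^esub> ?u)"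
  show ?thesis
  proof (rule A.not_subgroup_separableI)
    show S: "finite ?S" "?S \<subseteq> carrier ?A" "?x \<in> carrier ?A" using carr by auto
    let ?E = "{y \<in> carrier ?A. \<phi> y = \<psi> y}"
    have E: "subgroup ?E ?A" by (rule A.subgroupI) (auto intro!: exI[of _ "\<one>\<^bsub>?A\<^esub>"])
    have "\<phi> (inv\<^bsub>?A\<^esub> gc \<otimes>\<^bsub>?A\<^esub> ga) = \<psi> (inv\<^bsub>?A\<^esub> gc \<otimes>\<^bsub>?A\<^esub> ga)"
      "\<phi> (inv\<^bsub>?A\<^esub> gd \<otimes>\<^bsub>?A\<^esub> gb) = \<psi> (inv\<^bsub>?A\<^esub> gd \<otimes>\<^bsub>?A\<^esub> gb)" "\<phi> ?r = \<psi> ?r"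
      using carr PQ rel by (simp_all add: img del: perm_group_simps)
    then have "?S \<subseteq> ?E" using S(2) by blast
    then have "generate ?A ?S \<subseteq> ?E" using E by (rule A.generate_subgroup_incl)
    \<comment> \<open>The word involves only \<open>a\<close> and \<open>b\<close>, so
      \<open>\<psi>\<close> kills it. Under \<open>\<phi>\<close> the two orders of \<open>a\<close>
      and its conjugate \<open>?u\<close> differ: \<open>(0, 0)\<close> goes to
      \<open>(2, 0)\<close> when \<open>?u\<close> acts first and to \<open>(3, 0)\<close> when
      \<open>a\<close> does.\<close>
    moreover have "\<phi> ?x \<noteq> \<psi> ?x"
    proof
      assume "\<phi> ?x = \<psi> ?x"
      then have "\<phi> ?x = \<one>\<^bsub>?K\<^esub>" using carr by (simp add: img del: perm_group_simps)
      then have "\<phi> ?x (0, 0) = (0, 0)" by simp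
      then have "\<phi> (ga \<otimes>\<^bsub>?A\<^esub> ?u) (0, 0) = \<phi> (?u \<otimes>\<^bsub>?A\<^esub> ga) (0, 0)"
        by (subst (asm) hom_inv_mult_fixes_iff[OF A.group_axioms \<phi>]) (use carr in auto)
      moreover have "inv\<^bsub>?K\<^esub> bs_b = bs_b_inv"
        by (rule K.inv_equality) (simp_all add: fun_eq_iff bs_b_inverse bs_perms
            permutes_UNIV_if_inverse[OF bs_b_inverse(2,1)])
      ultimately show False
        using carr by (simp add: img bs_a_def bs_b_def bs_b_inv_def)
    qed
    ultimately show "?x \<notin> generate ?A ?S" by blast
    fix K assume K: "subgroup K ?A" "?S \<subseteq> K" and pow: "\<And>c. c \<in> carrier ?A \<Longrightarrow> \<exists>n::nat. n > 0 \<and> c [^]\<^bsub>?A\<^esub> n \<in> K"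
    show "?x \<in> K"
      by (rule A.square_word_mem[OF K(1) carr _ _ _ _ pow[OF carr(1)]])
        (use K(2) adj adj' raag_gen_commute in \<open>simp_all add: gdefs\<close>)
  qed
qed

lemma obstruction_imp_path_or_square:
  assumes "obstruction (verts G) (\<lambda>u v. u \<rightarrow>\<^bsub>G\<^esub> v)"
  shows "\<exists>cyc a b c d. path_or_square_in G cyc a b c d"
proof -
  obtain a b c d where "a \<in> verts G" "b \<in> verts G" "c \<in> verts G" "d \<in> verts G" "distinct [a, b, c, d]"
    "a \<rightarrow>\<^bsub>G\<^esub> b" "b \<rightarrow>\<^bsub>G\<^esub> c" "c \<rightarrow>\<^bsub>G\<^esub> d" "\<not> a \<rightarrow>\<^bsub>G\<^esub> c" "\<not> b \<rightarrow>\<^bsub>G\<^esub> d"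
    using assms unfolding obstruction_def by auto
  then have "path_or_square_in G (a \<rightarrow>\<^bsub>G\<^esub> d) a b c d" by (simp add: path_or_square_in_def)
  then show ?thesis by blast
qed

end

theorem theorem2:
  fixes X :: "('v, 'e) pre_digraph"
  assumes "graph X"
  shows "subgroup_separable (raag X) \<longleftrightarrow>
    \<not> has_full_subgraph_iso X square \<and> \<not> has_full_subgraph_iso X path_length_3"
proof -
  interpret graph X by fact
  show ?thesis
  proof
    assume "subgroup_separable (raag X)"
    then show "\<not> has_full_subgraph_iso X square \<and> \<not> has_full_subgraph_iso X path_length_3"
      unfolding full_square_iff full_path_length_3_iff
      using not_separable_if_path not_separable_if_square by blast
  next
    assume no: "\<not> has_full_subgraph_iso X square \<and> \<not> has_full_subgraph_iso X path_length_3"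
    have "\<not> path_or_square_in X cyc a b c d" for cyc a b c d
      using no unfolding full_square_iff full_path_length_3_iff by (cases cyc) auto
    then have "\<not> obstruction (verts X) (\<lambda>u v. u \<rightarrow>\<^bsub>X\<^esub> v)"
      using obstruction_imp_path_or_square by blast
    then show "subgroup_separable (raag X)" by (rule raag_subgroup_separable[OF assms])
  qed
qed

end
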